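(* Let $G$ be a planar or projective-planar graph of girth at least $6$. Then for every signature $\sigma:E(G)\to\{+,-\}$ on $G$, the signed graph $(G,\sigma)$ is (circular) $3$-colorable.
   Context: All graphs are finite. A signed graph $(G,\sigma)$ is a graph $G$ together with a signature $\sigma:E(G)\to\{+,-\}$. The girth of a graph is the length of its shortest cycle (a graph without cycles has infinite girth). A graph is projective-planar if it can be embedded in the real projective plane. Given positive integers $p,q$ with $p\ge 2q$ and $p$ even, a circular $\frac{p}{q}$-coloring of $(G,\sigma)$ is a mapping $\varphi:V(G)\to\{0,1,\ldots,p-1\}$ such that (i) for each positive edge $uv$, $q\le|\varphi(u)-\varphi(v)|\le p-q$, and (ii) for each negative edge $uv$, either $|\varphi(u)-\varphi(v)|\le \frac p2-q$ or $|\varphi(u)-\varphi(v)|\ge\frac p2+q$. A signed graph is (circular) $3$-colorable if it admits a circular $\frac{6}{2}$-coloring, i.e. one with $p=6$, $q=2$. *)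

theory Defs
  imports "HOL-Analysis.Analysis" "HOL-Library.Extended_Nat"
begin

section \<open>Finite graphs and girth\<close>

text \<open>An edge is the two-element set of its endpoints. Loops and parallel edges are cycles of
  length one and two, so a graph of girth at least three is necessarily of this form.\<close>

definition finite_graph :: "'a set \<Rightarrow> 'a set set \<Rightarrow> bool" where
  "finite_graph V E \<longleftrightarrow> finite V \<and> (\<forall>e\<in>E. e \<subseteq> V \<and> card e = 2)"

definition graph_cycle :: "'a set set \<Rightarrow> 'a list \<Rightarrow> bool" where
  "graph_cycle E c \<longleftrightarrow> 3 \<le> length c \<and> distinct c \<and>
     (\<forall>i<length c. {c ! i, c ! (Suc i mod length c)} \<in> E)"

text \<open>The infimum of the empty set in \<^typ>\<open>enat\<close> is \<open>\<infinity>\<close>, so acyclic graphs have infinite girth.\<close>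

definition girth :: "'a set set \<Rightarrow> enat" where
  "girth E = (INF c\<in>{c. graph_cycle E c}. enat (length c))"


section \<open>Topological embeddings of graphs\<close>

text \<open>In a drawing, \<open>f\<close> places the vertices and \<open>g e\<close> parametrises the simple arc that represents
  the edge \<open>e\<close>. In a Hausdorff space such a drawing of a finite graph is the same as a
  homeomorphic embedding of its geometric realisation.\<close>

definition graph_drawing ::
  "'b topology \<Rightarrow> 'a set \<Rightarrow> 'a set set \<Rightarrow> ('a \<Rightarrow> 'b) \<Rightarrow> ('a set \<Rightarrow> real \<Rightarrow> 'b) \<Rightarrow> bool" where
  "graph_drawing X V E f g \<longleftrightarrow>
     inj_on f V \<and> f ` V \<subseteq> topspace X \<and>
     (\<forall>e\<in>E. pathin X (g e) \<and> inj_on (g e) {0..1} \<and> {g e 0, g e 1} = f ` e \<and>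
            g e ` {0<..<1} \<inter> f ` V = {}) \<and>
     (\<forall>e\<in>E. \<forall>e'\<in>E. e \<noteq> e' \<longrightarrow> g e ` {0<..<1} \<inter> g e' ` {0<..<1} = {})"

definition embeddable_in :: "'b topology \<Rightarrow> 'a set \<Rightarrow> 'a set set \<Rightarrow> bool" where
  "embeddable_in X V E \<longleftrightarrow> (\<exists>f g. graph_drawing X V E f g)"

definition planar :: "'a set \<Rightarrow> 'a set set \<Rightarrow> bool" where
  "planar V E \<longleftrightarrow> embeddable_in (euclidean :: (real ^ 2) topology) V E"

definition quotient_topology :: "'b topology \<Rightarrow> ('b \<Rightarrow> 'c) \<Rightarrow> 'c topology" where
  "quotient_topology X h =
     topology (\<lambda>U. U \<subseteq> h ` topspace X \<and> openin X {x \<in> topspace X. h x \<in> U})"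

text \<open>The real projective plane is the unit sphere in \<open>\<real>\<^sup>3\<close> with antipodal points identified.\<close>

definition real_projective_plane :: "(real ^ 3) set topology" where
  "real_projective_plane = quotient_topology (top_of_set (sphere 0 1)) (\<lambda>x. {x, - x})"

definition projective_planar :: "'a set \<Rightarrow> 'a set set \<Rightarrow> bool" where
  "projective_planar V E \<longleftrightarrow> embeddable_in real_projective_plane V E"

lemma openin_quotient_topology:
  "openin (quotient_topology X h) U \<longleftrightarrow>
     U \<subseteq> h ` topspace X \<and> openin X {x \<in> topspace X. h x \<in> U}"
proof -
  have "istopology (\<lambda>U. U \<subseteq> h ` topspace X \<and> openin X {x \<in> topspace X. h x \<in> U})"
    unfolding istopology_def
  proof (intro conjI allI impI)
    fix S T
    assume S: "S \<subseteq> h ` topspace X \<and> openin X {x \<in> topspace X. h x \<in> S}"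
      and T: "T \<subseteq> h ` topspace X \<and> openin X {x \<in> topspace X. h x \<in> T}"
    show "S \<inter> T \<subseteq> h ` topspace X" using S by blast
    have "{x \<in> topspace X. h x \<in> S \<inter> T} = {x \<in> topspace X. h x \<in> S} \<inter> {x \<in> topspace X. h x \<in> T}"
      by blast
    then show "openin X {x \<in> topspace X. h x \<in> S \<inter> T}" using S T by auto
  next
    fix K
    assume K: "\<forall>S\<in>K. S \<subseteq> h ` topspace X \<and> openin X {x \<in> topspace X. h x \<in> S}"
    show "\<Union>K \<subseteq> h ` topspace X" using K by blast
    have "{x \<in> topspace X. h x \<in> \<Union>K} = (\<Union>S\<in>K. {x \<in> topspace X. h x \<in> S})"
      by blast
    then show "openin X {x \<in> topspace X. h x \<in> \<Union>K}" using K by auto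
  qed
  then show ?thesis
    by (simp add: quotient_topology_def topology_inverse')
qed

lemma topspace_quotient_topology: "topspace (quotient_topology X h) = h ` topspace X"
proof -
  have "{x \<in> topspace X. h x \<in> h ` topspace X} = topspace X" by blast
  then have "openin (quotient_topology X h) (h ` topspace X)"
    by (simp add: openin_quotient_topology)
  moreover have "topspace (quotient_topology X h) \<subseteq> h ` topspace X"
    using openin_quotient_topology[of X h "topspace (quotient_topology X h)"] by simp
  ultimately show ?thesis by (meson openin_subset subset_antisym)
qed

lemma quotient_map_quotient_topology: "quotient_map X (quotient_topology X h) h"
  by (simp add: quotient_map_def openin_quotient_topology topspace_quotient_topology)


section \<open>Signed graphs and circular colorings\<close>

datatype edge_sign = Pos | Neg

definition circular_coloring ::
  "nat \<Rightarrow> nat \<Rightarrow> 'a set \<Rightarrow> 'a set set \<Rightarrow> ('a set \<Rightarrow> edge_sign) \<Rightarrow> ('a \<Rightarrow> int) \<Rightarrow> bool" where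
  "circular_coloring p q V E \<sigma> \<phi> \<longleftrightarrow>
     0 < q \<and> 2 * q \<le> p \<and> even p \<and>
     (\<forall>v\<in>V. \<phi> v \<in> {0..int p - 1}) \<and>
     (\<forall>u v. {u, v} \<in> E \<and> \<sigma> {u, v} = Pos \<longrightarrow>
        int q \<le> \<bar>\<phi> u - \<phi> v\<bar> \<and> \<bar>\<phi> u - \<phi> v\<bar> \<le> int p - int q) \<and>
     (\<forall>u v. {u, v} \<in> E \<and> \<sigma> {u, v} = Neg \<longrightarrow>
        \<bar>\<phi> u - \<phi> v\<bar> \<le> int p div 2 - int q \<or> int p div 2 + int q \<le> \<bar>\<phi> u - \<phi> v\<bar>)"

definition circular_3_colorable :: "'a set \<Rightarrow> 'a set set \<Rightarrow> ('a set \<Rightarrow> edge_sign) \<Rightarrow> bool" where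
  "circular_3_colorable V E \<sigma> \<longleftrightarrow> (\<exists>\<phi>. circular_coloring 6 2 V E \<sigma> \<phi>)"

end

theory Submission
  imports Defs
begin

text \<open>Two facts are combined. First, every \<open>A \<subseteq> V\<close> spans at most \<open>(3 |A| - 3) / 2\<close> edges. A drawing in
  the projective plane lifts along the antipodal covering to a drawing on the sphere of a graph with
  \<open>2 |A|\<close> vertices, twice the edges and girth at least six, and for such a graph Euler's formula
  gives \<open>2 |E| + 6 \<le> 3 |V|\<close>.

  Second, this density bound alone makes every signature \<open>3\<close>-colorable. The signs are generalised to
  gains in \<open>\<int>/6\<close> and constraints \<open>\<phi> v - \<phi> u \<noteq> t\<close>, which weigh half an edge, are admitted. The gain is
  that a proper tight subset, once colored, can be contracted to a point, its coloring being
  absorbed into the gains. So in a minimal counterexample all proper subsets with at least two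
  elements have some slack, and a vertex of small degree can be deleted in exchange for new
  constraints between its neighbours.\<close>

section \<open>Sparse gain graphs\<close>

text \<open>Call \<open>3 |A| - 2 |H[A]| - |N[A]|\<close> the slack of A. The bound 3 is the slack
  of a single vertex, so a tight set looks like a point from outside; this is why contraction
  preserves sparsity. Eliminating a vertex of degree two trades one vertex and two edges for one
  constraint in \<open>N\<close>, and 2 * 2 - 3 = 1 is the weight that leaves the slack unchanged.
  Contraction shifts constraints by colors, so arbitrary gains and parallel constraints appear;
  signs on a simple graph are not closed under it. The obstacle is a vertex with one edge in
  \<open>H\<close> and three constraints in \<open>N\<close>: three colors are permitted and up to
  three are forbidden, so counting yields no free color, and a constraint that would help may
  destroy sparsity. On the topological side the same constant explains the passage to the sphere: 2
  (2 |E|) + 6 \<le> 3 (2 |V|) halves to exactly the bound required, without an Euler formula for the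
  projective plane.\<close>

definition near :: "6 set" where
  "near = {-1, 0, 1}"

lemma UNIV_6: "(UNIV :: 6 set) = {0, 1, 2, 3, 4, 5}"
proof -
  have "x \<in> {0, 1, 2, 3, 4, 5}" for x :: 6
  proof (cases x rule: bit0_cases)
    case (of_int z)
    then have "z \<in> {0..<6}" by simp
    then have "z \<in> {0, 1, 2, 3, 4, 5}" by auto
    then show ?thesis using of_int(1) by auto
  qed
  then show ?thesis by blast
qed

lemma all_6: "(\<forall>x :: 6. P x) \<longleftrightarrow> P 0 \<and> P 1 \<and> P 2 \<and> P 3 \<and> P 4 \<and> P 5"
proof -
  have "(\<forall>x :: 6. P x) \<longleftrightarrow> (\<forall>x \<in> UNIV. P x)" by simp
  then show ?thesis unfolding UNIV_6 by simp
qed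

lemma near_minus: "- x \<in> near \<longleftrightarrow> x \<in> near"
proof -
  have "\<forall>x. - x \<in> near \<longleftrightarrow> x \<in> near"
    unfolding all_6 by (simp add: near_def)
  then show ?thesis by simp
qed

lemma card_near: "card near = 3"
  by (simp add: near_def)

text \<open>The six colors split into two opposite arcs of three. Hence shifting a gain by 3 negates
  a constraint in \<open>H\<close>, which is how positive edges are encoded and how unwanted
  positions are excluded later.\<close>

lemma near_add_3: "x + 3 \<in> near \<longleftrightarrow> x \<notin> near"
proof -
  have "\<forall>x. x + 3 \<in> near \<longleftrightarrow> x \<notin> near"
    unfolding all_6 by (simp add: near_def)
  then show ?thesis by simp
qed

lemma near_overlap:
  assumes "d \<noteq> 3"
  shows "\<exists>c. c \<in> near \<and> c - d \<in> near"
proof -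
  have "\<forall>d. d \<noteq> 3 \<longrightarrow> (\<exists>c \<in> {-1,0,1}. c - d \<in> near)"
    unfolding all_6 by (auto simp: near_def)
  then show ?thesis using assms by (fold near_def) blast
qed

lemma near_overlap_2:
  assumes "d \<in> near"
  shows "\<exists>c c'. c \<noteq> c' \<and> c \<in> near \<and> c - d \<in> near \<and> c' \<in> near \<and> c' - d \<in> near"
proof -
  have "\<forall>d. d \<in> near \<longrightarrow> (\<exists>c \<in> {-1,0,1}. \<exists>c' \<in> {-1,0,1}. c \<noteq> c' \<and> c - d \<in> near \<and> c' - d \<in> near)"
    unfolding all_6 by (auto simp: near_def)
  then show ?thesis using assms by (fold near_def) blast
qed

text \<open>Two kinds of constraints \<open>(u, v, t)\<close> on a coloring \<open>\<phi>\<close> with values in \<open>\<int>/6\<close>: those in \<open>H\<close> ask for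
  \<open>\<phi> v - \<phi> u - t \<in> {-1, 0, 1}\<close> and those in \<open>N\<close> for \<open>\<phi> v - \<phi> u \<noteq> t\<close>. A signed edge is a
  constraint in \<open>H\<close> (\<open>t = 0\<close> if negative, \<open>t = 3\<close> if positive), and a path of two such edges through a
  vertex of degree two amounts to a constraint in \<open>N\<close>. Both orientations of a constraint are
  stored, so \<open>load\<close> counts an edge of \<open>H\<close> four times and one of \<open>N\<close> twice; \<open>sparse\<close> says that
  \<open>3 |A| - 2 |H[A]| - |N[A]| \<ge> 3\<close> for all nonempty \<open>A\<close>.\<close>

definition gain_sym :: "('a \<times> 'a \<times> 6) set \<Rightarrow> bool" where
  "gain_sym H \<longleftrightarrow> (\<forall>u v t. (u, v, t) \<in> H \<longrightarrow> (v, u, - t) \<in> H)"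

definition inside_edges :: "('a \<times> 'a \<times> 6) set \<Rightarrow> 'a set \<Rightarrow> ('a \<times> 'a \<times> 6) set" where
  "inside_edges H A = {(u, v, t). (u, v, t) \<in> H \<and> u \<in> A \<and> v \<in> A}"

definition load :: "('a \<times> 'a \<times> 6) set \<Rightarrow> ('a \<times> 'a \<times> 6) set \<Rightarrow> 'a set \<Rightarrow> nat" where
  "load H N A = 2 * card (inside_edges H A) + card (inside_edges N A)"

definition sparse :: "'a set \<Rightarrow> ('a \<times> 'a \<times> 6) set \<Rightarrow> ('a \<times> 'a \<times> 6) set \<Rightarrow> bool" where
  "sparse V H N \<longleftrightarrow> (\<forall>A \<subseteq> V. A \<noteq> {} \<longrightarrow> load H N A + 6 \<le> 6 * card A)"

definition gain_coloring ::
  "'a set \<Rightarrow> ('a \<times> 'a \<times> 6) set \<Rightarrow> ('a \<times> 'a \<times> 6) set \<Rightarrow> ('a \<Rightarrow> 6) \<Rightarrow> bool" where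
  "gain_coloring V H N \<phi> \<longleftrightarrow>
     (\<forall>u v t. (u, v, t) \<in> inside_edges H V \<longrightarrow> \<phi> v - \<phi> u - t \<in> near) \<and>
     (\<forall>u v t. (u, v, t) \<in> inside_edges N V \<longrightarrow> \<phi> v - \<phi> u \<noteq> t)"

lemma finite_inside_edges: "finite A \<Longrightarrow> finite (inside_edges H A)"
  by (rule finite_subset[of _ "A \<times> A \<times> UNIV"]) (auto simp: inside_edges_def)

lemma inside_edges_mono: "A \<subseteq> B \<Longrightarrow> inside_edges H A \<subseteq> inside_edges H B"
  by (auto simp: inside_edges_def)

lemma inside_edges_Int: "inside_edges H (A \<inter> B) = inside_edges H A \<inter> inside_edges H B"
  by (auto simp: inside_edges_def)

text \<open>Supermodularity: the union gains the constraints that run between \<open>A - B\<close>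
  and \<open>B - A\<close>, and equality means that there are none.\<close>

lemma card_inside_edges_Un:
  assumes "finite A" "finite B"
  shows "card (inside_edges H A) + card (inside_edges H B) \<le> card (inside_edges H (A \<union> B)) + card (inside_edges H (A \<inter> B))"
    and "card (inside_edges H (A \<union> B)) + card (inside_edges H (A \<inter> B)) \<le> card (inside_edges H A) + card (inside_edges H B)
      \<Longrightarrow> inside_edges H (A \<union> B) = inside_edges H A \<union> inside_edges H B"
proof -
  have fin: "finite (inside_edges H (A \<union> B))" using assms by (simp add: finite_inside_edges)
  have sub: "inside_edges H A \<union> inside_edges H B \<subseteq> inside_edges H (A \<union> B)" by (auto simp: inside_edges_def)
  have "card (inside_edges H A) + card (inside_edges H B)
      = card (inside_edges H A \<union> inside_edges H B) + card (inside_edges H (A \<inter> B))"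
    using card_Un_Int[of "inside_edges H A" "inside_edges H B"] assms
    by (simp add: finite_inside_edges inside_edges_Int)
  moreover have "card (inside_edges H A \<union> inside_edges H B) \<le> card (inside_edges H (A \<union> B))"
    using fin sub by (rule card_mono)
  ultimately show "card (inside_edges H A) + card (inside_edges H B)
      \<le> card (inside_edges H (A \<union> B)) + card (inside_edges H (A \<inter> B))"
    and "card (inside_edges H (A \<union> B)) + card (inside_edges H (A \<inter> B)) \<le> card (inside_edges H A) + card (inside_edges H B)
      \<Longrightarrow> inside_edges H (A \<union> B) = inside_edges H A \<union> inside_edges H B"
    using card_subset_eq[OF fin sub] by (linarith, simp)
qed

lemma load_Un:
  assumes "finite A" "finite B"
  shows "load H N A + load H N B \<le> load H N (A \<union> B) + load H N (A \<inter> B)"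
  using card_inside_edges_Un(1)[OF assms, of H] card_inside_edges_Un(1)[OF assms, of N]
  unfolding load_def by linarith

lemma load_Un_eq:
  assumes "finite A" "finite B"
    and "load H N (A \<union> B) + load H N (A \<inter> B) \<le> load H N A + load H N B"
  shows "inside_edges H (A \<union> B) = inside_edges H A \<union> inside_edges H B"
    and "inside_edges N (A \<union> B) = inside_edges N A \<union> inside_edges N B"
  using assms(3) card_inside_edges_Un[OF assms(1,2), of H] card_inside_edges_Un[OF assms(1,2), of N]
  unfolding load_def by linarith+

lemma sparse_subset: "sparse V H N \<Longrightarrow> A \<subseteq> V \<Longrightarrow> sparse A H N"
  unfolding sparse_def by blast

text \<open>For a singleton the bound leaves no room: 6 is all that one vertex provides.\<close>

lemma sparse_no_loops:
  assumes "sparse V H N" "v \<in> V"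
  shows "(v, v, t) \<notin> H" "(v, v, t) \<notin> N"
proof -
  have "load H N {v} = 0"
    using assms unfolding sparse_def by (auto dest: spec[of _ "{v}"])
  then have "inside_edges H {v} = {}" "inside_edges N {v} = {}"
    by (auto simp: load_def finite_inside_edges)
  then show "(v, v, t) \<notin> H" "(v, v, t) \<notin> N"
    by (auto simp: inside_edges_def)
qed

text \<open>Pairs instead of vertices: contraction creates parallel constraints with different
  gains, and each of them counts.\<close>

definition nbrs :: "('a \<times> 'a \<times> 6) set \<Rightarrow> 'a \<Rightarrow> 'a set \<Rightarrow> ('a \<times> 6) set" where
  "nbrs H v A = {(x, t). x \<in> A \<and> (v, x, t) \<in> H}"

lemma finite_nbrs: "finite A \<Longrightarrow> finite (nbrs H v A)"
  by (rule finite_subset[of _ "A \<times> UNIV"]) (auto simp: nbrs_def)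

lemma card_inside_edges_insert:
  assumes "finite A" "v \<notin> A" "gain_sym H" "\<And>t. (v, v, t) \<notin> H"
  shows "card (inside_edges H (insert v A)) = card (inside_edges H A) + 2 * card (nbrs H v A)"
proof -
  let ?S = "nbrs H v A"
  have eq: "inside_edges H (insert v A) = inside_edges H A \<union> (Pair v ` ?S \<union> (\<lambda>(x, t). (x, v, - t)) ` ?S)"
  proof (intro equalityI subsetI)
    fix e assume e: "e \<in> inside_edges H (insert v A)"
    obtain a b t where abt: "e = (a, b, t)" by (cases e)
    have "(b, a, - t) \<in> H" using e abt assms(3) by (auto simp: inside_edges_def gain_sym_def)
    moreover have "(a, b, t) \<in> (\<lambda>(x, t). (x, v, - t)) ` ?S"
      if "b = v" "a \<in> A" "(b, a, - t) \<in> H"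
      using that by (intro image_eqI[of _ _ "(a, - t)"]) (auto simp: nbrs_def)
    ultimately show "e \<in> inside_edges H A \<union> (Pair v ` ?S \<union> (\<lambda>(x, t). (x, v, - t)) ` ?S)"
      using e abt assms(4) by (auto simp: inside_edges_def nbrs_def image_iff)
  next
    fix e assume "e \<in> inside_edges H A \<union> (Pair v ` ?S \<union> (\<lambda>(x, t). (x, v, - t)) ` ?S)"
    then show "e \<in> inside_edges H (insert v A)"
      using assms(3) by (auto simp: inside_edges_def nbrs_def gain_sym_def)
  qed
  have "card (Pair v ` ?S \<union> (\<lambda>(x, t). (x, v, - t)) ` ?S) = card ?S + card ?S"
  proof (subst card_Un_disjoint)
    show "Pair v ` ?S \<inter> (\<lambda>(x, t). (x, v, - t)) ` ?S = {}"
      using assms(2) by (auto simp: nbrs_def)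
    show "card (Pair v ` ?S) + card ((\<lambda>(x, t). (x, v, - t)) ` ?S) = card ?S + card ?S"
      by (subst (1 2) card_image) (auto simp: inj_on_def)
  qed (use assms(1) in \<open>auto simp: finite_nbrs\<close>)
  moreover have "inside_edges H A \<inter> (Pair v ` ?S \<union> (\<lambda>(x, t). (x, v, - t)) ` ?S) = {}"
    using assms(2) by (auto simp: inside_edges_def)
  ultimately show ?thesis
    unfolding eq by (subst card_Un_disjoint) (use assms(1) in \<open>auto simp: finite_inside_edges finite_nbrs\<close>)
qed

text \<open>Without loops the two orientations of a constraint in \<open>N\<close> are distinct
  triples. Parity later turns a strict inequality between loads into a gain of two.\<close>

lemma even_load:
  assumes "finite A" "gain_sym N" "\<And>v t. v \<in> A \<Longrightarrow> (v, v, t) \<notin> N"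
  shows "even (load H N A)"
proof -
  have "even (card (inside_edges N A))"
    using assms(1,3)
  proof (induction A rule: finite_induct)
    case empty
    have "inside_edges N {} = {}" by (auto simp: inside_edges_def)
    then show ?case by simp
  next
    case (insert v A)
    then show ?case using assms(2) by (simp add: card_inside_edges_insert)
  qed
  then show ?thesis by (simp add: load_def)
qed

lemma gain_coloring_cong:
  "gain_coloring A H N \<psi> \<Longrightarrow> (\<And>a. a \<in> A \<Longrightarrow> \<phi> a = \<psi> a + c) \<Longrightarrow> gain_coloring A H N \<phi>"
  unfolding gain_coloring_def inside_edges_def by auto

lemma load_insert:
  assumes "finite A" "v \<notin> A" "gain_sym H" "gain_sym N" "\<And>t. (v, v, t) \<notin> H" "\<And>t. (v, v, t) \<notin> N"
  shows "load H N (insert v A) = load H N A + 2 * (2 * card (nbrs H v A) + card (nbrs N v A))"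
  using assms by (simp add: load_def card_inside_edges_insert)

text \<open>Contract \<open>A\<close> to a point and absorb its coloring \<open>\<psi>\<close> into the gains.\<close>

definition contract_edges ::
  "'a set \<Rightarrow> 'a set \<Rightarrow> 'a \<Rightarrow> ('a \<Rightarrow> 6) \<Rightarrow> ('a \<times> 'a \<times> 6) set \<Rightarrow> ('a \<times> 'a \<times> 6) set" where
  "contract_edges V A a \<psi> H =
     (\<lambda>(u, v, t). (if u \<in> A then a else u, if v \<in> A then a else v,
        t + (if u \<in> A then \<psi> u else 0) - (if v \<in> A then \<psi> v else 0)))
     ` (inside_edges H V - inside_edges H A)"

lemma gain_sym_contract_edges:
  assumes "gain_sym H"
  shows "gain_sym (contract_edges V A a \<psi> H)"
  unfolding gain_sym_def
proof (intro allI impI)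
  fix u v t
  assume "(u, v, t) \<in> contract_edges V A a \<psi> H"
  then obtain x y s where e: "(x, y, s) \<in> inside_edges H V - inside_edges H A"
    "u = (if x \<in> A then a else x)" "v = (if y \<in> A then a else y)"
    "t = s + (if x \<in> A then \<psi> x else 0) - (if y \<in> A then \<psi> y else 0)"
    by (auto simp: contract_edges_def)
  have "(y, x, - s) \<in> inside_edges H V - inside_edges H A"
    using e(1) assms by (auto simp: inside_edges_def gain_sym_def)
  then show "(v, u, - t) \<in> contract_edges V A a \<psi> H"
    unfolding contract_edges_def using e(2-4)
    by (intro image_eqI[of _ _ "(y, x, - s)"]) auto
qed

text \<open>Constraints may be merged by the contraction, so these are inequalities. A constraint on
  a set C through the new point a comes from one inside \<open>C \<union> A\<close> but not inside
  A.\<close>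

lemma card_contract_edges:
  assumes "finite V" "A \<subseteq> V" "a \<in> A" "C \<subseteq> insert a (V - A)"
  shows "a \<notin> C \<Longrightarrow> card (inside_edges (contract_edges V A a \<psi> H) C) \<le> card (inside_edges H C)"
    and "a \<in> C \<Longrightarrow> card (inside_edges (contract_edges V A a \<psi> H) C) + card (inside_edges H A)
      \<le> card (inside_edges H (C \<union> A))"
proof -
  let ?f = "\<lambda>(u, v, t). (if u \<in> A then a else u, if v \<in> A then a else v,
        t + (if u \<in> A then \<psi> u else 0) - (if v \<in> A then \<psi> v else 0))"
  have finC: "finite C" using assms by (metis finite_Diff finite_insert finite_subset)
  {
    assume "a \<notin> C"
    have "inside_edges (contract_edges V A a \<psi> H) C \<subseteq> inside_edges H C"
      using \<open>a \<notin> C\<close> by (auto simp: contract_edges_def inside_edges_def split: if_splits)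
    then show "card (inside_edges (contract_edges V A a \<psi> H) C) \<le> card (inside_edges H C)"
      using finC by (meson card_mono finite_inside_edges)
  }
  {
    assume "a \<in> C"
    have fin: "finite (inside_edges H (C \<union> A))"
      using assms finC finite_subset by (metis finite_UnI finite_inside_edges)
    have "inside_edges (contract_edges V A a \<psi> H) C \<subseteq> ?f ` (inside_edges H (C \<union> A) - inside_edges H A)"
    proof
      fix e assume e: "e \<in> inside_edges (contract_edges V A a \<psi> H) C"
      then have "e \<in> ?f ` (inside_edges H V - inside_edges H A)"
        by (auto simp: inside_edges_def contract_edges_def)
      then obtain u v t where uvt: "(u, v, t) \<in> inside_edges H V - inside_edges H A" "e = ?f (u, v, t)"
        by (metis (no_types, lifting) imageE prod_cases3)
      have "(u, v, t) \<in> inside_edges H (C \<union> A) - inside_edges H A"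
        using uvt e by (auto simp: inside_edges_def split: if_splits)
      then show "e \<in> ?f ` (inside_edges H (C \<union> A) - inside_edges H A)"
        unfolding uvt(2) by (rule imageI)
    qed
    then have "card (inside_edges (contract_edges V A a \<psi> H) C)
        \<le> card (inside_edges H (C \<union> A) - inside_edges H A)"
      using fin by (meson finite_Diff surj_card_le)
    also have "\<dots> = card (inside_edges H (C \<union> A)) - card (inside_edges H A)"
      using fin by (meson Un_upper2 card_Diff_subset finite_subset inside_edges_mono)
    finally show "card (inside_edges (contract_edges V A a \<psi> H) C) + card (inside_edges H A)
      \<le> card (inside_edges H (C \<union> A))"
      using card_mono[OF fin inside_edges_mono[of A "C \<union> A" H]] by simp
  }
qed

text \<open>The last assumption says that no superset of A in V has less slack than A. What C adds
  to A is then at most \<open>6 * (card C - 1)\<close>, since C and A share only a; this is the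
  sparsity bound for C. Stated this way it also covers sets that are not tight but have least slack
  among their supersets.\<close>

lemma sparse_contract:
  assumes "finite V" "A \<subseteq> V" "a \<in> A" "sparse V H N"
    and "\<And>C. A \<subseteq> C \<Longrightarrow> C \<subseteq> V \<Longrightarrow> load H N C + 6 * card A \<le> load H N A + 6 * card C"
  shows "sparse (insert a (V - A)) (contract_edges V A a \<psi> H) (contract_edges V A a \<psi> N)"
  unfolding sparse_def
proof (intro allI impI)
  let ?H = "contract_edges V A a \<psi> H" and ?N = "contract_edges V A a \<psi> N"
  fix C assume C: "C \<subseteq> insert a (V - A)" "C \<noteq> {}"
  note card = card_contract_edges[OF assms(1-3) C(1), of \<psi>]
  show "load ?H ?N C + 6 \<le> 6 * card C"
  proof (cases "a \<in> C")
    case False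
    then have "load ?H ?N C \<le> load H N C" using card(1)[of H] card(1)[of N] by (simp add: load_def)
    moreover have "load H N C + 6 \<le> 6 * card C"
      using assms(4) C False unfolding sparse_def by blast
    ultimately show ?thesis by simp
  next
    case True
    then have "load ?H ?N C + load H N A \<le> load H N (C \<union> A)"
      using card(2)[of H] card(2)[of N] by (simp add: load_def)
    moreover have "load H N (C \<union> A) + 6 * card A \<le> load H N A + 6 * card (C \<union> A)"
      using assms(2,3) C by (intro assms(5)) auto
    moreover have "card (C \<union> A) + 1 = card C + card A"
    proof -
      have "C \<inter> A = {a}" using C True assms(3) by blast
      moreover have "finite C" "finite A"
        using C assms(1,2) finite_subset by (auto intro: finite_subset[of C "insert a (V - A)"])
      ultimately show ?thesis using card_Un_Int[of C A] by simp
    qed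
    ultimately show ?thesis by linarith
  qed
qed

lemma gain_coloring_contract:
  assumes "A \<subseteq> V" "a \<in> A" "gain_coloring A H N \<psi>"
    and "gain_coloring (insert a (V - A)) (contract_edges V A a \<psi> H) (contract_edges V A a \<psi> N) \<phi>"
  shows "gain_coloring V H N (\<lambda>u. if u \<in> A then \<phi> a + \<psi> u else \<phi> u)"
proof -
  let ?\<phi> = "\<lambda>u. if u \<in> A then \<phi> a + \<psi> u else \<phi> u"
  let ?p = "\<lambda>u. if u \<in> A then a else u" and ?d = "\<lambda>u. if u \<in> A then \<psi> u else 0"
  have phi: "?\<phi> v - ?\<phi> u = \<phi> (?p v) - \<phi> (?p u) + ?d v - ?d u" for u v by simp
  have "?\<phi> v - ?\<phi> u = \<psi> v - \<psi> u" if "u \<in> A" "v \<in> A" for u v using that by simp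
  moreover have "(?p u, ?p v, t + ?d u - ?d v) \<in>
      inside_edges (contract_edges V A a \<psi> K) (insert a (V - A))"
    if "(u, v, t) \<in> inside_edges K V" "\<not> (u \<in> A \<and> v \<in> A)" for u v t K
  proof -
    have "(?p u, ?p v, t + ?d u - ?d v) \<in> contract_edges V A a \<psi> K"
      unfolding contract_edges_def
      using that by (intro image_eqI[of _ _ "(u, v, t)"]) (auto simp: inside_edges_def)
    then show ?thesis using that by (auto simp: inside_edges_def)
  qed note outer = this
  ultimately show ?thesis
    unfolding gain_coloring_def
  proof (intro conjI allI impI)
    fix u v t assume e: "(u, v, t) \<in> inside_edges H V"
    show "?\<phi> v - ?\<phi> u - t \<in> near"
    proof (cases "u \<in> A \<and> v \<in> A")
      case True
      then show ?thesis using e assms(3) by (simp add: gain_coloring_def inside_edges_def)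
    next
      case False
      have "\<phi> (?p v) - \<phi> (?p u) - (t + ?d u - ?d v) \<in> near"
        using outer[OF e False] assms(4) unfolding gain_coloring_def by blast
      then show ?thesis unfolding phi by (simp add: algebra_simps)
    qed
  next
    fix u v t assume e: "(u, v, t) \<in> inside_edges N V"
    show "?\<phi> v - ?\<phi> u \<noteq> t"
    proof (cases "u \<in> A \<and> v \<in> A")
      case True
      then show ?thesis using e assms(3) by (simp add: gain_coloring_def inside_edges_def)
    next
      case False
      have "\<phi> (?p v) - \<phi> (?p u) \<noteq> t + ?d u - ?d v"
        using outer[OF e False] assms(4) unfolding gain_coloring_def by blast
      then show ?thesis unfolding phi by (simp add: algebra_simps)
    qed
  qed
qed

section \<open>New constraints, and extension of a coloring to one more vertex\<close>

definition add_edge :: "'a \<Rightarrow> 'a \<Rightarrow> 6 \<Rightarrow> ('a \<times> 'a \<times> 6) set \<Rightarrow> ('a \<times> 'a \<times> 6) set" where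
  "add_edge x y t H = insert (x, y, t) (insert (y, x, - t) H)"

lemma gain_sym_add_edge: "gain_sym H \<Longrightarrow> gain_sym (add_edge x y t H)"
  by (auto simp: gain_sym_def add_edge_def)

lemma card_inside_edges_add_edge:
  assumes "finite A"
  shows "card (inside_edges (add_edge x y t H) A)
    \<le> card (inside_edges H A) + (if x \<in> A \<and> y \<in> A then 2 else 0)"
proof -
  have "inside_edges (add_edge x y t H) A \<subseteq>
      (if x \<in> A \<and> y \<in> A then insert (x, y, t) (insert (y, x, - t) (inside_edges H A)) else inside_edges H A)"
    by (auto simp: inside_edges_def add_edge_def)
  then have "card (inside_edges (add_edge x y t H) A) \<le> card
      (if x \<in> A \<and> y \<in> A then insert (x, y, t) (insert (y, x, - t) (inside_edges H A)) else inside_edges H A)"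
    using assms by (intro card_mono) (auto simp: finite_inside_edges)
  also have "\<dots> \<le> card (inside_edges H A) + (if x \<in> A \<and> y \<in> A then 2 else 0)"
    using card_Un_le[of "{(x, y, t), (y, x, - t)}" "inside_edges H A"]
      card_insert_le_m1[of 2 "{(y, x, - t)}" "(x, y, t)"] by (simp split: if_split)
  finally show ?thesis .
qed

text \<open>A constraint in \<open>H\<close> adds at most 4 to the load of a set that contains both
  ends, hence 10 = 6 + 4. In \<open>N\<close> it adds at most 2, hence the 8 of
  \<open>sparse_add_neq\<close>.\<close>

lemma sparse_add_near:
  assumes "finite V" "sparse V H N"
    and "\<And>A. A \<subseteq> V \<Longrightarrow> x \<in> A \<Longrightarrow> y \<in> A \<Longrightarrow> load H N A + 10 \<le> 6 * card A"
  shows "sparse V (add_edge x y t H) N"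
  unfolding sparse_def
proof (intro allI impI)
  fix A assume A: "A \<subseteq> V" "A \<noteq> {}"
  then have "finite A" using assms(1) finite_subset by blast
  note card_inside_edges_add_edge[OF this, of x y t H]
  moreover have "load H N A + 6 \<le> 6 * card A" using A assms(2) unfolding sparse_def by blast
  ultimately show "load (add_edge x y t H) N A + 6 \<le> 6 * card A"
    using assms(3)[OF A(1)] by (auto simp: load_def split: if_splits)
qed

lemma sparse_add_neq:
  assumes "finite V" "sparse V H N"
    and "\<And>A. A \<subseteq> V \<Longrightarrow> x \<in> A \<Longrightarrow> y \<in> A \<Longrightarrow> load H N A + 8 \<le> 6 * card A"
  shows "sparse V H (add_edge x y t N)"
  unfolding sparse_def
proof (intro allI impI)
  fix A assume A: "A \<subseteq> V" "A \<noteq> {}"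
  then have "finite A" using assms(1) finite_subset by blast
  note card_inside_edges_add_edge[OF this, of x y t N]
  moreover have "load H N A + 6 \<le> 6 * card A" using A assms(2) unfolding sparse_def by blast
  ultimately show "load H (add_edge x y t N) A + 6 \<le> 6 * card A"
    using assms(3)[OF A(1)] by (auto simp: load_def split: if_splits)
qed

lemma gain_coloring_add_near:
  "gain_coloring V (add_edge x y t H) N \<phi> \<longleftrightarrow>
     gain_coloring V H N \<phi> \<and> (x \<in> V \<and> y \<in> V \<longrightarrow> \<phi> y - \<phi> x - t \<in> near)"
proof -
  have "\<phi> x - \<phi> y + t \<in> near \<longleftrightarrow> \<phi> y - \<phi> x - t \<in> near"
    using near_minus[of "\<phi> y - \<phi> x - t"] by (simp add: algebra_simps)
  then show ?thesis
    by (auto simp: gain_coloring_def inside_edges_def add_edge_def)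
qed

lemma gain_coloring_add_neq:
  "gain_coloring V H (add_edge x y t N) \<phi> \<longleftrightarrow>
     gain_coloring V H N \<phi> \<and> (x \<in> V \<and> y \<in> V \<longrightarrow> \<phi> y - \<phi> x \<noteq> t)"
  by (auto simp: gain_coloring_def inside_edges_def add_edge_def algebra_simps)

lemma gain_coloring_extend:
  assumes "gain_coloring V H N \<phi>" "v \<notin> V" "gain_sym H" "gain_sym N"
    and "\<And>t. (v, v, t) \<notin> H" "\<And>t. (v, v, t) \<notin> N"
    and H: "\<And>x t. (x, t) \<in> nbrs H v V \<Longrightarrow> \<phi> x - t - c \<in> near"
    and N: "\<And>x t. (x, t) \<in> nbrs N v V \<Longrightarrow> \<phi> x - t \<noteq> c"
  shows "gain_coloring (insert v V) H N (\<phi>(v := c))"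
proof -
  have "c - \<phi> x - t \<in> near" if "(x, v, t) \<in> H" "x \<in> V" for x t
  proof -
    have "(x, - t) \<in> nbrs H v V" using that assms(3) by (auto simp: nbrs_def gain_sym_def)
    then show ?thesis using H near_minus[of "c - \<phi> x - t"] by (fastforce simp: algebra_simps)
  qed
  moreover have "c - \<phi> x \<noteq> t" if "(x, v, t) \<in> N" "x \<in> V" for x t
  proof -
    have "(x, - t) \<in> nbrs N v V" using that assms(4) by (auto simp: nbrs_def gain_sym_def)
    then show ?thesis using N by (fastforce simp: algebra_simps)
  qed
  moreover have "\<phi> x - c - t \<in> near" if "(v, x, t) \<in> H" "x \<in> V" for x t
    using H[of x t] that by (simp add: nbrs_def algebra_simps)
  moreover have "\<phi> x - c \<noteq> t" if "(v, x, t) \<in> N" "x \<in> V" for x t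
    using N[of x t] that by (auto simp: nbrs_def algebra_simps)
  moreover have "u \<noteq> v" if "u \<in> V" for u using that assms(2) by blast
  ultimately show ?thesis
    using assms(1,5,6) unfolding gain_coloring_def inside_edges_def by simp
qed

lemma card_inside_edges_eq_sum:
  assumes "finite V"
  shows "card (inside_edges H V) = (\<Sum>v\<in>V. card (nbrs H v V))"
proof -
  have "inside_edges H V = (SIGMA v:V. nbrs H v V)"
    by (auto simp: inside_edges_def nbrs_def)
  then show ?thesis using assms by (simp add: card_SigmaI finite_nbrs)
qed

lemma load_eq_sum:
  "finite V \<Longrightarrow> load H N V = (\<Sum>v\<in>V. 2 * card (nbrs H v V) + card (nbrs N v V))"
  by (simp add: load_def card_inside_edges_eq_sum sum.distrib sum_distrib_left)

lemma card_near_shift: "card {c :: 6. a - c \<in> near} = 3"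
proof -
  have "{c. a - c \<in> near} = (\<lambda>k. a - k) ` near"
    by (auto intro: image_eqI[of _ _ "a - _"])
  then show ?thesis by (simp add: card_image inj_on_def card_near)
qed

lemma near_diff_commute: "a - b \<in> near \<longleftrightarrow> b - a \<in> (near :: 6 set)"
  using near_minus[of "a - b"] by simp

lemma near_diff_3: "x - 3 \<in> near \<longleftrightarrow> x \<notin> near"
  using near_add_3[of "x - 3"] by auto

section \<open>Colorability of sparse gain graphs: the minimal counterexample\<close>

theorem sparse_gain_colorable:
  assumes "finite V" "gain_sym H" "gain_sym N" "sparse V H N"
  shows "\<exists>\<phi>. gain_coloring V H N \<phi>"
  using assms
proof (induction "card V" arbitrary: V H N rule: less_induct)
  case less
  note IH = less.hyps and fin = less.prems(1) and symH = less.prems(2)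
    and symN = less.prems(3) and sparse = less.prems(4)
  note noloops = sparse_no_loops[OF sparse]
  show ?case
  proof (rule ccontr)
    assume nocol: "\<nexists>\<phi>. gain_coloring V H N \<phi>"
    \<comment> \<open>The condition \<open>small\<close> makes the contracted graph smaller than V.
      For \<open>W = V\<close> this means at least two elements in A; for W missing a vertex any
      nonempty A will do.\<close>
    have contract: "\<exists>\<phi> c. gain_coloring W H N \<phi> \<and> (\<forall>u\<in>A. \<phi> u = c + \<psi> u)"
      if W: "W \<subseteq> V" and A: "A \<subseteq> W" "A \<noteq> {}" and psi: "gain_coloring A H N \<psi>"
        and small: "card W + 1 < card V + card A"
        and dense: "\<And>C. A \<subseteq> C \<Longrightarrow> C \<subseteq> W \<Longrightarrow> load H N C + 6 * card A \<le> load H N A + 6 * card C"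
      for W A \<psi>
    proof -
      obtain a where a: "a \<in> A" using A by blast
      have finW: "finite W" using W fin finite_subset by blast
      have "card (insert a (W - A)) + card A = card W + 1"
        using a A finW by (subst card_insert_disjoint) (auto simp: card_Diff_subset finite_subset card_mono)
      then have "card (insert a (W - A)) < card V" using small by linarith
      moreover have "sparse (insert a (W - A)) (contract_edges W A a \<psi> H) (contract_edges W A a \<psi> N)"
        using sparse_contract[OF finW A(1) a sparse_subset[OF sparse W] dense] .
      moreover have "finite (insert a (W - A))" using finW by simp
      ultimately have "\<exists>\<phi>. gain_coloring (insert a (W - A))
          (contract_edges W A a \<psi> H) (contract_edges W A a \<psi> N) \<phi>"
        by (intro IH gain_sym_contract_edges symH symN)
      then obtain \<phi> where
        "gain_coloring (insert a (W - A)) (contract_edges W A a \<psi> H) (contract_edges W A a \<psi> N) \<phi>" ..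
      from gain_coloring_contract[OF A(1) a psi this]
      show ?thesis
        by (rule_tac x = "\<lambda>u. if u \<in> A then \<phi> a + \<psi> u else \<phi> u" in exI, rule_tac x = "\<phi> a" in exI) simp
    qed
    have sub: "\<exists>\<phi>. gain_coloring A H N \<phi>" if "A \<subset> V" for A
      using IH[of A] that fin symH symN sparse_subset[OF sparse] psubset_card_mono finite_subset
      by (metis psubset_imp_subset)
    have even: "even (load H N A)" if "A \<subseteq> V" for A
      using even_load[of A N H] noloops that fin symN finite_subset by blast
    text \<open>Otherwise \<open>A\<close> is tight: color it by minimality, contract it and color the rest.\<close>
    have gap: "load H N A + 8 \<le> 6 * card A" if A: "A \<subset> V" "2 \<le> card A" for A
    proof (rule ccontr)
      assume *: "\<not> ?thesis"
      have le: "load H N C + 6 \<le> 6 * card C" if "C \<subseteq> V" "C \<noteq> {}" for C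
        using sparse that unfolding sparse_def by blast
      have ne: "A \<noteq> {}" using A by auto
      have "load H N A + 6 \<le> 6 * card A" using le[of A] A ne by blast
      moreover have "even (load H N A + 6)" "even (6 * card A)" using even[of A] A by auto
      ultimately have eq: "load H N A + 6 = 6 * card A" using * by presburger
      obtain \<psi> where "gain_coloring A H N \<psi>" using sub[OF A(1)] by blast
      moreover have "load H N C + 6 * card A \<le> load H N A + 6 * card C" if "A \<subseteq> C" "C \<subseteq> V" for C
      proof -
        have "C \<noteq> {}" using that ne by blast
        then show ?thesis using le[of C] that eq by linarith
      qed
      ultimately have "\<exists>\<phi> c. gain_coloring V H N \<phi> \<and> (\<forall>u\<in>A. \<phi> u = c + \<psi> u)"
        using A ne by (intro contract) auto
      then show False using nocol by blast
    qed
    \<comment> \<open>The weighted degrees sum to \<open>load H N V\<close>, which is less than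
      \<open>6 * card V\<close>.\<close>
    have "\<exists>v\<in>V. 2 * card (nbrs H v V) + card (nbrs N v V) \<le> 5"
    proof (rule ccontr)
      assume "\<not> ?thesis"
      then have "(\<Sum>v\<in>V. 6) \<le> load H N V"
        unfolding load_eq_sum[OF fin] by (intro sum_mono) (auto simp: not_le)
      moreover have "V \<noteq> {}"
        using nocol by (auto simp: gain_coloring_def inside_edges_def)
      then have "load H N V + 6 \<le> 6 * card V" using sparse unfolding sparse_def by blast
      ultimately show False by simp
    qed
    then obtain v where v: "v \<in> V" and low: "2 * card (nbrs H v V) + card (nbrs N v V) \<le> 5" by blast
    define W where "W = V - {v}"
    have W: "W \<subset> V" "v \<notin> W" "insert v W = V" "finite W" using v fin by (auto simp: W_def)
    have nbrs_W: "nbrs H v V = nbrs H v W" "nbrs N v V = nbrs N v W"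
      using noloops[OF v] by (auto simp: nbrs_def W_def)
    have load_v: "load H N (insert v A) = load H N A + 2 * (2 * card (nbrs H v A) + card (nbrs N v A))"
      if "A \<subseteq> W" for A
      using that W noloops[OF v] symH symN finite_subset by (intro load_insert) blast+
    \<comment> \<open>The 6 in the sparsity of \<open>insert v A\<close> pays for v. If
      \<open>insert v A\<close> is moreover a proper subset of V, then \<open>gap\<close> provides
      two more units; this is \<open>gap_v\<close>.\<close>
    have sparse_v: "load H N A + 2 * (2 * card (nbrs H v A) + card (nbrs N v A)) \<le> 6 * card A"
      if "A \<subseteq> W" for A
    proof -
      have "load H N (insert v A) + 6 \<le> 6 * card (insert v A)"
        using sparse that W v unfolding sparse_def by (metis insert_mono insert_not_empty)
      moreover have "card (insert v A) = card A + 1"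
        using that W finite_subset by (subst card_insert_disjoint) auto
      ultimately show ?thesis using load_v[OF that] by simp
    qed
    have gap_v: "load H N A + 2 * (2 * card (nbrs H v A) + card (nbrs N v A)) + 2 \<le> 6 * card A"
      if "A \<subset> W" "A \<noteq> {}" for A
    proof -
      have "card (insert v A) = card A + 1"
        using that W finite_subset by (subst card_insert_disjoint) auto
      moreover have "card A \<noteq> 0" using that W finite_subset by (metis card_eq_0_iff psubset_imp_subset)
      moreover have "insert v A \<subset> V" using that W by blast
      ultimately show ?thesis using gap[of "insert v A"] load_v[of A] that by auto
    qed
    \<comment> \<open>Colors that \<open>H\<close> permits at v and colors that \<open>N\<close>
      forbids there. Since V has no coloring, every permitted color is forbidden, whatever the
      coloring of W.\<close>
    define P where "P \<phi> = {c. \<forall>(x, t) \<in> nbrs H v W. \<phi> x - t - c \<in> near}" for \<phi>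
    define F where "F \<phi> = (\<lambda>(x, t). \<phi> x - t) ` nbrs N v W" for \<phi> :: "'a \<Rightarrow> 6"
    have stuck: "P \<phi> \<subseteq> F \<phi>" if "gain_coloring W H N \<phi>" for \<phi>
    proof
      fix c assume c: "c \<in> P \<phi>"
      show "c \<in> F \<phi>"
      proof (rule ccontr)
        assume "c \<notin> F \<phi>"
        with c have "gain_coloring (insert v W) H N (\<phi>(v := c))"
          using that W symH symN noloops[OF v]
          by (intro gain_coloring_extend) (auto simp: P_def F_def)
        then show False using nocol W by auto
      qed
    qed
    have card_F: "card (F \<phi>) \<le> card (nbrs N v W)" for \<phi>
      unfolding F_def using W by (intro card_image_le finite_nbrs)
    have card_P: "card (P \<phi>) \<le> card (nbrs N v W)" if "gain_coloring W H N \<phi>" for \<phi>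
      using card_mono[OF _ stuck[OF that]] card_F[of \<phi>] by (simp add: le_trans)
    have IH_W: "\<exists>\<phi>. gain_coloring W H' N' \<phi>" if "gain_sym H'" "gain_sym N'" "sparse W H' N'" for H' N'
      using IH[of W] that W fin by (simp add: psubset_card_mono)
    have sparse_W: "sparse W H N" using sparse_subset[OF sparse] W by blast
    obtain \<phi>0 where \<phi>0: "gain_coloring W H N \<phi>0" using sub W by blast
    \<comment> \<open>With 0, 1 or 2 constraints in \<open>H\<close> at v, at most 5, 3 or 1 in
      \<open>N\<close> remain. The first case is immediate, as all six colors are permitted.\<close>
    note low' = low[unfolded nbrs_W]
    then consider "card (nbrs H v W) = 0" | "card (nbrs H v W) = 1" | "card (nbrs H v W) = 2" by linarith
    then show False
    proof cases
      case 1
      then have "nbrs H v W = {}" using W finite_nbrs by fastforce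
      then have "card (P \<phi>0) = 6" by (simp add: P_def)
      then show False using card_P[OF \<phi>0] low' by simp
    next
      text \<open>Delete \<open>v\<close>; a new constraint between \<open>x\<close> and \<open>y\<close> makes the two intervals of colors that they
        leave for \<open>v\<close> overlap sufficiently.\<close>
      case 3
      then obtain x t y s where xy: "nbrs H v W = {(x, t), (y, s)}" "(x, t) \<noteq> (y, s)"
        by (auto simp: card_2_iff)
      have mem: "x \<in> W" "y \<in> W" using xy by (auto simp: nbrs_def)
      have nbrs_A: "card (nbrs H v A) = 2" if "A \<subseteq> W" "x \<in> A" "y \<in> A" for A
      proof -
        have "nbrs H v A = nbrs H v W" using that xy by (auto simp: nbrs_def)
        then show ?thesis using 3 by simp
      qed
      \<comment> \<open>Parallel constraints to the same vertex would claim 8 units from a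
        singleton, which has 6.\<close>
      have "x \<noteq> y"
        using sparse_v[of "{x}"] nbrs_A[of "{x}"] mem by auto
      have P: "\<phi> x - t - c \<in> P \<phi>" if "c \<in> near" "c - ((\<phi> x - t) - (\<phi> y - s)) \<in> near" for \<phi> c
        using that by (simp add: P_def xy algebra_simps)
      show False
      proof (cases "card (nbrs N v W) = 0")
        case True
        \<comment> \<open>The permitted arcs, centred at \<open>\<phi> x - t\<close> and
          \<open>\<phi> y - s\<close>, are disjoint only if the centres are antipodal. One
          constraint in \<open>N\<close> excludes that, and the two edges deleted with v leave the
          slack for it.\<close>
        have "sparse W H (add_edge x y (s - t + 3) N)"
        proof (rule sparse_add_neq)
          fix A assume "A \<subseteq> W" "x \<in> A" "y \<in> A"
          then show "load H N A + 8 \<le> 6 * card A" using sparse_v[of A] nbrs_A[of A] by simp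
        qed (use W sparse_W in auto)
        then obtain \<phi> where "gain_coloring W H (add_edge x y (s - t + 3) N) \<phi>"
          using IH_W[OF symH gain_sym_add_edge[OF symN]] by blast
        then have \<phi>: "gain_coloring W H N \<phi>" "\<phi> y - \<phi> x \<noteq> s - t + 3"
          using mem by (auto simp: gain_coloring_add_neq)
        have "(\<phi> x - t) - (\<phi> y - s) \<noteq> 3"
        proof
          assume "(\<phi> x - t) - (\<phi> y - s) = 3"
          then have "\<phi> y - \<phi> x = s - t - 3" by (simp add: algebra_simps)
          moreover have "s - t - 3 = s - t + (3 :: 6)"
            by (simp add: diff_eq_eq add.assoc)
          ultimately show False using \<phi> by simp
        qed
        then obtain c where "\<phi> x - t - c \<in> P \<phi>" using P near_overlap by blast
        then show False using card_P[OF \<phi>(1)] True by (metis card_0_eq empty_iff finite le_zero_eq)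
      next
        case False
        then have one: "card (nbrs N v W) = 1" using low' 3 by linarith
        have "sparse W (add_edge x y (s - t) H) N"
        proof (rule sparse_add_near)
          \<comment> \<open>Eight of the ten units come from the two edges at v; the other two come
            from its constraint in \<open>N\<close> if \<open>A = W\<close>, and from the gap
            otherwise.\<close>
          fix A assume A: "A \<subseteq> W" "x \<in> A" "y \<in> A"
          show "load H N A + 10 \<le> 6 * card A"
          proof (cases "A = W")
            case True
            then show ?thesis using sparse_v[of A] nbrs_A[of A] A one by simp
          next
            case False
            then have "A \<subset> W" "A \<noteq> {}" using A by auto
            then show ?thesis using gap_v[of A] nbrs_A[of A] A by simp
          qed
        qed (use W sparse_W in auto)
        then obtain \<phi> where "gain_coloring W (add_edge x y (s - t) H) N \<phi>"
          using IH_W[OF gain_sym_add_edge[OF symH] symN] by blast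
        then have \<phi>: "gain_coloring W H N \<phi>" "\<phi> y - \<phi> x - (s - t) \<in> near"
          using mem by (auto simp: gain_coloring_add_near)
        then have "(\<phi> x - t) - (\<phi> y - s) \<in> near"
          using near_diff_commute[of "\<phi> x - t" "\<phi> y - s"] by (simp add: algebra_simps)
        from near_overlap_2[OF this] obtain c c' where c: "c \<noteq> c'"
          "\<phi> x - t - c \<in> P \<phi>" "\<phi> x - t - c' \<in> P \<phi>" using P by metis
        have "card {\<phi> x - t - c, \<phi> x - t - c'} \<le> card (P \<phi>)"
          using c by (intro card_mono) auto
        then show False using c card_P[OF \<phi>(1)] one by simp
      qed
    next
      text \<open>Only if the three neighbours in \<open>N\<close> forbid exactly the three colors that \<open>x\<close> leaves for \<open>v\<close>
        is there no color for \<open>v\<close>. A new edge between \<open>x\<close> and one of them would exclude this. If each of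
        these edges is too much for some subset, two of the subsets meet only in \<open>x\<close>; they have enough
        colorings to make two neighbours forbid the same color, and their union can be contracted.\<close>
      case 2
      then obtain x t where x: "nbrs H v W = {(x, t)}" by (metis card_1_singletonE surj_pair)
      have xW: "x \<in> W" using x by (auto simp: nbrs_def)
      have P: "P \<phi> = {c. \<phi> x - t - c \<in> near}" for \<phi> by (simp add: P_def x)
      have three: "card (nbrs N v W) = 3"
        using card_P[OF \<phi>0] low' 2 card_near_shift[of "\<phi>0 x - t"] by (simp add: P)
      \<comment> \<open>Position of the color forbidden by (z, s) relative to the centre of the arc
        that x permits. It is invariant under shifting all colors, so it survives
        contraction.\<close>
      define val where "val = (\<lambda>\<phi> (z, s). \<phi> z - s - (\<phi> x - t) :: 6)"
      \<comment> \<open>Three permitted colors inside a set of at most three forbidden ones: the two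
        sets agree, and distinct constraints forbid distinct colors.\<close>
      have bad: "val \<phi> e \<in> near" "inj_on (val \<phi>) (nbrs N v W)"
        if "gain_coloring W H N \<phi>" "e \<in> nbrs N v W" for \<phi> e
      proof -
        have eq: "P \<phi> = F \<phi>"
          using stuck[OF that(1)] card_F[of \<phi>] three card_near_shift[of "\<phi> x - t"]
          by (intro card_seteq) (auto simp: P)
        obtain z s where e: "e = (z, s)" by (cases e)
        have "\<phi> z - s \<in> P \<phi>" unfolding eq F_def using that e by (auto intro: image_eqI[of _ _ e])
        then show "val \<phi> e \<in> near"
          using near_diff_commute[of "\<phi> x - t" "\<phi> z - s"] by (simp add: P val_def e)
        have "card (F \<phi>) = card (nbrs N v W)"
          using eq three card_near_shift[of "\<phi> x - t"] by (simp add: P)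
        then have "inj_on (\<lambda>(x, t). \<phi> x - t) (nbrs N v W)"
          unfolding F_def using W by (intro eq_card_imp_inj_on finite_nbrs)
        moreover have "val \<phi> e = (case e of (x, t) \<Rightarrow> \<phi> x - t) - (\<phi> x - t)" for e
          by (cases e) (simp add: val_def)
        ultimately show "inj_on (val \<phi>) (nbrs N v W)"
          by (simp add: inj_on_def)
      qed
      have nbrs_A: "card (nbrs H v A) = 1" if "A \<subseteq> W" "x \<in> A" for A
      proof -
        have "nbrs H v A = nbrs H v W" using that x by (auto simp: nbrs_def)
        then show ?thesis using 2 by simp
      qed
      \<comment> \<open>For \<open>A = W\<close> the ten units are 2 * (2 + 3). For smaller A they
        are 2 * (2 + 2) plus the two units of the gap.\<close>
      have two: "load H N A + 10 \<le> 6 * card A"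
        if "A \<subseteq> W" "x \<in> A" "A = W \<or> 2 \<le> card (nbrs N v A)" for A
      proof (cases "A = W")
        case True
        then show ?thesis using sparse_v[of A] nbrs_A[of A] that three by simp
      next
        case False
        then have "A \<subset> W" "A \<noteq> {}" "2 \<le> card (nbrs N v A)" using that by auto
        then show ?thesis using gap_v[of A] nbrs_A[of A] that by simp
      qed
      have neq_x: "z \<noteq> x" if "(z, s) \<in> nbrs N v W" for z s
      proof
        assume "z = x"
        then have "(z, s) \<in> nbrs N v {x}" using that by (auto simp: nbrs_def)
        then have "1 \<le> card (nbrs N v {x})"
          using finite_nbrs[of "{x}" N v] by (metis One_nat_def Suc_leI card_gt_0_iff empty_iff finite.emptyI finite_insert)
        then show False
          using gap_v[of "{x}"] two[of "{x}"] nbrs_A[of "{x}"] xW by (cases "{x} = W") auto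
      qed
      have obstruction: "\<exists>A. A \<subset> W \<and> x \<in> A \<and> nbrs N v A = {(z, s)} \<and> load H N A + 8 = 6 * card A"
        if zs: "(z, s) \<in> nbrs N v W" for z s
      proof -
        have zW: "z \<in> W" using zs by (auto simp: nbrs_def)
        \<comment> \<open>The gain is shifted by 3, so this constraint asks for \<open>val\<close>
          outside \<open>near\<close>, contrary to \<open>bad\<close>.\<close>
        have "\<not> sparse W (add_edge x z (s - t + 3) H) N"
        proof
          assume "sparse W (add_edge x z (s - t + 3) H) N"
          then obtain \<phi> where "gain_coloring W (add_edge x z (s - t + 3) H) N \<phi>"
            using IH_W[OF gain_sym_add_edge[OF symH] symN] by blast
          then have \<phi>: "gain_coloring W H N \<phi>" "\<phi> z - \<phi> x - (s - t + 3) \<in> near"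
            using xW zW by (auto simp: gain_coloring_add_near)
          have "\<phi> z - \<phi> x - (s - t + 3) = val \<phi> (z, s) - 3" by (simp add: val_def algebra_simps)
          then show False using \<phi> bad(1)[OF \<phi>(1) zs] near_diff_3 by metis
        qed
        then obtain A where A: "A \<subseteq> W" "x \<in> A" "z \<in> A" "\<not> load H N A + 10 \<le> 6 * card A"
          using sparse_add_near[OF W(4) sparse_W, of x z] by blast
        have zsA: "(z, s) \<in> nbrs N v A" using zs A by (auto simp: nbrs_def)
        have AW: "A \<noteq> W" "card (nbrs N v A) < 2" using two[OF A(1,2)] A(4) by (blast, meson not_le)
        have finA: "finite A" using A W finite_subset by blast
        have "nbrs N v A = {(z, s)}"
        proof -
          have "card (nbrs N v A) \<noteq> 0" using zsA finite_nbrs[OF finA, of N v] by (metis card_0_eq empty_iff)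
          then have "card (nbrs N v A) = 1" using AW by linarith
          then show ?thesis using zsA by (metis card_1_singletonE singletonD)
        qed
        moreover have "2 \<le> card A"
          using card_mono[of A "{x, z}"] A finA neq_x[OF zs] by auto
        then have "load H N A + 8 \<le> 6 * card A" using gap[of A] A AW W by blast
        moreover have "even (load H N A)" using even A W by blast
        moreover have "even (6 * card A)" by simp
        ultimately have "load H N A + 8 = 6 * card A" using A(4) by presburger
        then show ?thesis using A AW \<open>nbrs N v A = {(z, s)}\<close> by blast
      qed
      \<comment> \<open>Inside A every set with two elements has slack for one constraint in
        \<open>N\<close>, so any prescribed value c of \<open>val\<close> can be excluded. Applied
        twice, this gives two different values.\<close>
      have recolor: "\<exists>\<psi>. gain_coloring A H N \<psi> \<and> val \<psi> (z, s) \<noteq> c"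
        if A: "A \<subset> W" "x \<in> A" "nbrs N v A = {(z, s)}" for A z s c
      proof -
        have zA: "z \<in> A" "(z, s) \<in> nbrs N v W" using A by (auto simp: nbrs_def)
        have finA: "finite A" using A W finite_subset by blast
        have "sparse A H (add_edge x z (c + s - t) N)"
        proof (rule sparse_add_neq[OF finA])
          show "sparse A H N" using sparse_subset[OF sparse_W] A by blast
          fix B assume B: "B \<subseteq> A" "x \<in> B" "z \<in> B"
          then have "2 \<le> card B"
            using card_mono[of B "{x, z}"] finA finite_subset neq_x[OF zA(2)] by fastforce
          then show "load H N B + 8 \<le> 6 * card B" using gap[of B] B A W by blast
        qed
        moreover have "card A < card V" using A W fin by (meson psubset_card_mono psubset_trans)
        ultimately obtain \<psi> where "gain_coloring A H (add_edge x z (c + s - t) N) \<psi>"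
          using IH[OF _ finA symH gain_sym_add_edge[OF symN]] by blast
        then have "gain_coloring A H N \<psi>" "\<psi> z - \<psi> x \<noteq> c + s - t"
          using A zA by (auto simp: gain_coloring_add_neq)
        then show ?thesis by (intro exI[of _ \<psi>]) (auto simp: val_def algebra_simps)
      qed
      have contract_W: "\<exists>\<phi>. gain_coloring W H N \<phi> \<and> (\<forall>z\<in>B. \<forall>s. val \<phi> (z, s) = val \<psi> (z, s))"
        if B: "B \<subseteq> W" "x \<in> B" "gain_coloring B H N \<psi>"
          and C: "\<And>C. B \<subseteq> C \<Longrightarrow> C \<subseteq> W \<Longrightarrow> load H N C + 6 * card B \<le> load H N B + 6 * card C" for B \<psi>
      proof -
        have "card W < card V" using W fin by (simp add: psubset_card_mono)
        moreover have "card B \<noteq> 0" using B W finite_subset by fastforce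
        ultimately have "card W + 1 < card V + card B" by linarith
        moreover have "W \<subseteq> V" "B \<noteq> {}" using W B by auto
        ultimately have "\<exists>\<phi> c. gain_coloring W H N \<phi> \<and> (\<forall>u\<in>B. \<phi> u = c + \<psi> u)"
          using B C by (intro contract) auto
        then obtain \<phi> c where "gain_coloring W H N \<phi>" "\<And>u. u \<in> B \<Longrightarrow> \<phi> u = c + \<psi> u"
          by blast
        then show ?thesis using B by (intro exI[of _ \<phi>]) (auto simp: val_def)
      qed
      define D where "D A e = {val \<psi> e | \<psi>. gain_coloring A H N \<psi>}" for A e
      have D: "D A (z, s) \<subseteq> near \<and> 2 \<le> card (D A (z, s))"
        if A: "A \<subset> W" "x \<in> A" "nbrs N v A = {(z, s)}" "load H N A + 8 = 6 * card A" for A z s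
      proof
        have zA: "z \<in> A" "(z, s) \<in> nbrs N v W" using A by (auto simp: nbrs_def)
        show "D A (z, s) \<subseteq> near"
        proof
          fix d assume "d \<in> D A (z, s)"
          then obtain \<psi> where \<psi>: "gain_coloring A H N \<psi>" "d = val \<psi> (z, s)" by (auto simp: D_def)
          \<comment> \<open>A is not tight, but by \<open>gap\<close> no set C between A and W has
            less slack, so A can be contracted within W. The coloring thus extends to W, where
            \<open>bad\<close> confines \<open>val\<close> to \<open>near\<close>.\<close>
          have "load H N C + 6 * card A \<le> load H N A + 6 * card C" if "A \<subseteq> C" "C \<subseteq> W" for C
          proof -
            have "finite C" using that W finite_subset by blast
            moreover have "{x, z} \<subseteq> C" using A zA that by blast
            ultimately have "2 \<le> card C"
              using card_mono[of C "{x, z}"] neq_x[OF zA(2)] by auto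
            moreover have "C \<subset> V" using that W by blast
            ultimately show ?thesis using gap[of C] A(4) by linarith
          qed
          then obtain \<phi> where "gain_coloring W H N \<phi>" "val \<phi> (z, s) = d"
            using contract_W[of A \<psi>] A \<psi> zA by blast
          then show "d \<in> near" using bad(1) zA(2) by blast
        qed
        obtain d where d: "d \<in> D A (z, s)" using recolor[OF A(1-3)] unfolding D_def by blast
        obtain d' where d': "d' \<in> D A (z, s)" "d' \<noteq> d" using recolor[OF A(1-3), of d] unfolding D_def by blast
        show "2 \<le> card (D A (z, s))"
          using card_mono[of "D A (z, s)" "{d, d'}"] d d' by auto
      qed
      obtain z1 s1 z2 s2 where z: "(z1, s1) \<in> nbrs N v W" "(z2, s2) \<in> nbrs N v W" "(z1, s1) \<noteq> (z2, s2)"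
      proof -
        obtain e1 e2 e3 where "nbrs N v W = {e1, e2, e3}" "e1 \<noteq> e2" using three by (auto simp: card_3_iff)
        then show ?thesis using that[of "fst e1" "snd e1" "fst e2" "snd e2"] by auto
      qed
      obtain A1 where A1: "A1 \<subset> W" "x \<in> A1" "nbrs N v A1 = {(z1, s1)}" "load H N A1 + 8 = 6 * card A1"
        using obstruction[OF z(1)] by blast
      obtain A2 where A2: "A2 \<subset> W" "x \<in> A2" "nbrs N v A2 = {(z2, s2)}" "load H N A2 + 8 = 6 * card A2"
        using obstruction[OF z(2)] by blast
      have fin12: "finite A1" "finite A2" using A1 A2 W finite_subset by blast+
      \<comment> \<open>Two subsets of the three-element set \<open>near\<close> with at least two
        elements each must meet.\<close>
      have "D A1 (z1, s1) \<inter> D A2 (z2, s2) \<noteq> {}"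
      proof
        assume "D A1 (z1, s1) \<inter> D A2 (z2, s2) = {}"
        then have "card (D A1 (z1, s1) \<union> D A2 (z2, s2)) = card (D A1 (z1, s1)) + card (D A2 (z2, s2))"
          by (intro card_Un_disjoint) auto
        moreover have "card (D A1 (z1, s1) \<union> D A2 (z2, s2)) \<le> card near"
          using D[OF A1] D[OF A2] by (intro card_mono) auto
        ultimately show False using D[OF A1] D[OF A2] card_near by linarith
      qed
      then obtain \<psi>1 \<psi>2 where psi: "gain_coloring A1 H N \<psi>1" "gain_coloring A2 H N \<psi>2"
        "val \<psi>1 (z1, s1) = val \<psi>2 (z2, s2)"
        by (auto simp: D_def)
      let ?B = "A1 \<union> A2"
      have dense: "load H N C + 10 \<le> 6 * card C" if "?B \<subseteq> C" "C \<subseteq> W" for C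
      proof -
        have "finite C" using that W finite_subset by blast
        moreover have "nbrs N v A1 \<subseteq> nbrs N v C" "nbrs N v A2 \<subseteq> nbrs N v C"
          using that by (auto simp: nbrs_def)
        then have "{(z1, s1), (z2, s2)} \<subseteq> nbrs N v C" using A1(3) A2(3) by simp
        ultimately have "2 \<le> card (nbrs N v C)"
          using card_mono[OF finite_nbrs, of C "{(z1, s1), (z2, s2)}" N v] z(3) by auto
        then show ?thesis using two[of C] that A1 by blast
      qed
      have cardB: "card ?B + card (A1 \<inter> A2) = card A1 + card A2"
        using card_Un_Int[OF fin12] by simp
      have loadB: "load H N A1 + load H N A2 \<le> load H N ?B + load H N (A1 \<inter> A2)"
        using load_Un[OF fin12] .
      have denseB: "load H N ?B + 10 \<le> 6 * card ?B" using dense[of ?B] A1 A2 by blast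
      \<comment> \<open>In terms of \<open>6 |A| - load\<close>, A1 and A2 have 8 + 8, while the
        union and a larger intersection would have at least 10 + 8, against supermodularity of the
        load.\<close>
      have "\<not> 2 \<le> card (A1 \<inter> A2)"
      proof
        assume "2 \<le> card (A1 \<inter> A2)"
        then have "load H N (A1 \<inter> A2) + 8 \<le> 6 * card (A1 \<inter> A2)" using A1 W by (intro gap) auto
        then show False using cardB loadB denseB A1(4) A2(4) by linarith
      qed
      moreover have "card (A1 \<inter> A2) \<noteq> 0" using A1 A2 fin12 by auto
      ultimately have "card (A1 \<inter> A2) = 1" by linarith
      then have Int: "A1 \<inter> A2 = {x}" using A1(2) A2(2) by (metis IntI card_1_singletonE singletonD)
      \<comment> \<open>The common vertex has 6, and 8 + 8 = 10 + 6. Equality holds throughout, so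
        no constraint joins \<open>A1 - {x}\<close> to \<open>A2 - {x}\<close> and colorings of the
        two sets can be glued.\<close>
      have "load H N (A1 \<inter> A2) = 0"
        using sparse xW W unfolding Int sparse_def by (auto dest: spec[of _ "{x}"])
      then have eqB: "load H N ?B + 10 = 6 * card ?B"
        and "load H N ?B + load H N (A1 \<inter> A2) \<le> load H N A1 + load H N A2"
        using cardB loadB denseB A1(4) A2(4) \<open>card (A1 \<inter> A2) = 1\<close> by linarith+
      note edges = load_Un_eq[OF fin12 this(2)]
      \<comment> \<open>The second coloring is shifted so as to agree with the first at x.\<close>
      define \<psi> where "\<psi> = (\<lambda>u. if u \<in> A1 then \<psi>1 u else \<psi>2 u + (\<psi>1 x - \<psi>2 x))"
      have \<psi>1: "\<psi> u = \<psi>1 u + 0" if "u \<in> A1" for u using that by (simp add: \<psi>_def)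
      have \<psi>2: "\<psi> u = \<psi>2 u + (\<psi>1 x - \<psi>2 x)" if "u \<in> A2" for u
      proof (cases "u \<in> A1")
        case True
        then have "u = x" using that Int by blast
        then show ?thesis using True by (simp add: \<psi>_def)
      qed (simp add: \<psi>_def)
      have "gain_coloring A1 H N \<psi>" "gain_coloring A2 H N \<psi>"
        using gain_coloring_cong[OF psi(1) \<psi>1] gain_coloring_cong[OF psi(2) \<psi>2] by auto
      then have "gain_coloring ?B H N \<psi>"
        unfolding gain_coloring_def edges by blast
      moreover have "load H N C + 6 * card ?B \<le> load H N ?B + 6 * card C" if "?B \<subseteq> C" "C \<subseteq> W" for C
        using dense[OF that] eqB by linarith
      ultimately obtain \<phi> where \<phi>: "gain_coloring W H N \<phi>"
        "\<And>z s. z \<in> ?B \<Longrightarrow> val \<phi> (z, s) = val \<psi> (z, s)"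
        using contract_W[of ?B \<psi>] A1 A2 by (metis Un_iff Un_least psubset_imp_subset)
      have "(z1, s1) \<in> nbrs N v A1" "(z2, s2) \<in> nbrs N v A2" using A1(3) A2(3) by simp_all
      then have zA: "z1 \<in> A1" "z2 \<in> A2" by (auto simp: nbrs_def)
      have "val \<psi> (z1, s1) = val \<psi>1 (z1, s1)" "val \<psi> (z2, s2) = val \<psi>2 (z2, s2)"
        using \<psi>1[OF zA(1)] \<psi>1[OF A1(2)] \<psi>2[OF zA(2)] by (simp_all add: val_def)
      then have "val \<phi> (z1, s1) = val \<phi> (z2, s2)" using \<phi>(2) zA psi(3) by simp
      then show False using bad(2)[OF \<phi>(1) z(1)] z by (meson inj_onD)
    qed
  qed
qed

text \<open>The representatives 0, ..., 5 turn cyclic distance into the integer ranges that p = 6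
  and q = 2 prescribe for negative and positive edges.\<close>

lemma near_representatives:
  obtains r :: "6 \<Rightarrow> int"
  where "\<And>x. r x \<in> {0..5}"
    and "\<And>x y. y - x \<in> near \<Longrightarrow> \<bar>r x - r y\<bar> \<le> 1 \<or> 5 \<le> \<bar>r x - r y\<bar>"
    and "\<And>x y. y - x - 3 \<in> near \<Longrightarrow> 2 \<le> \<bar>r x - r y\<bar> \<and> \<bar>r x - r y\<bar> \<le> 4"
proof
  let ?r = "\<lambda>x :: 6. if x = 0 then 0 else if x = 1 then 1 else if x = 2 then 2
    else if x = 3 then 3 else if x = 4 then 4 else (5 :: int)"
  show "?r x \<in> {0..5}" for x by auto
  have "\<forall>x y. (y - x \<in> near \<longrightarrow> \<bar>?r x - ?r y\<bar> \<le> 1 \<or> 5 \<le> \<bar>?r x - ?r y\<bar>) \<and>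
    (y - x - 3 \<in> near \<longrightarrow> 2 \<le> \<bar>?r x - ?r y\<bar> \<and> \<bar>?r x - ?r y\<bar> \<le> 4)"
    unfolding all_6 by (simp add: near_def)
  then show "y - x \<in> near \<Longrightarrow> \<bar>?r x - ?r y\<bar> \<le> 1 \<or> 5 \<le> \<bar>?r x - ?r y\<bar>"
    and "y - x - 3 \<in> near \<Longrightarrow> 2 \<le> \<bar>?r x - ?r y\<bar> \<and> \<bar>?r x - ?r y\<bar> \<le> 4" for x y
    by blast+
qed

theorem sparse_circular_3_colorable:
  fixes V :: "'a set"
  assumes "finite_graph V E"
    and dense: "\<And>A. A \<subseteq> V \<Longrightarrow> A \<noteq> {} \<Longrightarrow> 2 * card {e \<in> E. e \<subseteq> A} + 3 \<le> 3 * card A"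
  shows "circular_3_colorable V E \<sigma>"
proof -
  define \<tau> where "\<tau> e = (if \<sigma> e = Neg then 0 else 3 :: 6)" for e
  define H where "H = {(u, v, t). {u, v} \<in> E \<and> t = \<tau> {u, v}}"
  have fin: "finite V" and E: "\<And>e. e \<in> E \<Longrightarrow> e \<subseteq> V \<and> card e = 2"
    using assms(1) by (auto simp: finite_graph_def)
  \<comment> \<open>In the integers mod 6 both 0 and 3 are their own negatives, so an undirected
    signed edge yields a symmetric constraint.\<close>
  have "- \<tau> e = \<tau> e" for e by (simp add: \<tau>_def)
  then have "gain_sym H" by (auto simp: gain_sym_def H_def insert_commute)
  moreover have "gain_sym {}" by (simp add: gain_sym_def)
  moreover have "sparse V H {}"
    unfolding sparse_def
  proof (intro allI impI)
    fix A assume A: "A \<subseteq> V" "A \<noteq> {}"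
    have finA: "finite A" using A fin finite_subset by blast
    have finE: "finite {e \<in> E. e \<subseteq> A}" using finA by (auto intro: finite_subset[of _ "Pow A"])
    have "inside_edges H A \<subseteq> (\<Union>e \<in> {e \<in> E. e \<subseteq> A}. {(u, v, t). {u, v} = e \<and> t = \<tau> e})"
      by (auto simp: inside_edges_def H_def)
    moreover have two: "finite {(u, v, t). {u, v} = e \<and> t = \<tau> e}
        \<and> card {(u, v, t). {u, v} = e \<and> t = \<tau> e} \<le> 2" if "e \<in> E" for e
    proof -
      obtain x y where "e = {x, y}" using E[OF \<open>e \<in> E\<close>] by (auto simp: card_2_iff)
      then have "{(u, v, t). {u, v} = e \<and> t = \<tau> e} = {(x, y, \<tau> e), (y, x, \<tau> e)}"
        by (auto simp: doubleton_eq_iff)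
      then show ?thesis using card_insert_le_m1[of 2 "{(y, x, \<tau> e)}" "(x, y, \<tau> e)"] by simp
    qed
    ultimately have "card (inside_edges H A)
        \<le> card (\<Union>e \<in> {e \<in> E. e \<subseteq> A}. {(u, v, t). {u, v} = e \<and> t = \<tau> e})"
      using finE by (intro card_mono) auto
    also have "\<dots> \<le> (\<Sum>e \<in> {e \<in> E. e \<subseteq> A}. card {(u, v, t). {u, v} = e \<and> t = \<tau> e})"
      using finE by (rule card_UN_le)
    also have "\<dots> \<le> (\<Sum>e \<in> {e \<in> E. e \<subseteq> A}. 2)"
      using two by (intro sum_mono) auto
    finally have "card (inside_edges H A) \<le> 2 * card {e \<in> E. e \<subseteq> A}" by simp
    moreover have "inside_edges ({} :: ('a \<times> 'a \<times> 6) set) A = {}" by (auto simp: inside_edges_def)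
    ultimately show "load H {} A + 6 \<le> 6 * card A"
      using dense[OF A] by (simp add: load_def)
  qed
  ultimately obtain \<phi> where \<phi>: "gain_coloring V H {} \<phi>"
    using sparse_gain_colorable[OF fin] by blast
  obtain r :: "6 \<Rightarrow> int" where r: "\<And>x. r x \<in> {0..5}"
    "\<And>x y. y - x \<in> near \<Longrightarrow> \<bar>r x - r y\<bar> \<le> 1 \<or> 5 \<le> \<bar>r x - r y\<bar>"
    "\<And>x y. y - x - 3 \<in> near \<Longrightarrow> 2 \<le> \<bar>r x - r y\<bar> \<and> \<bar>r x - r y\<bar> \<le> 4"
    using near_representatives by blast
  have edge: "\<phi> v - \<phi> u - \<tau> {u, v} \<in> near" if "{u, v} \<in> E" for u v
    using \<phi> that E[OF that] by (auto simp: gain_coloring_def inside_edges_def H_def)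
  have "circular_coloring 6 2 V E \<sigma> (\<lambda>v. r (\<phi> v))"
    unfolding circular_coloring_def
  proof (intro conjI allI ballI impI)
    fix v show "r (\<phi> v) \<in> {0..int 6 - 1}" using r(1)[of "\<phi> v"] by simp
  next
    fix u v assume "{u, v} \<in> E \<and> \<sigma> {u, v} = Pos"
    then have "2 \<le> \<bar>r (\<phi> u) - r (\<phi> v)\<bar> \<and> \<bar>r (\<phi> u) - r (\<phi> v)\<bar> \<le> 4"
      using r(3) edge[of u v] by (simp add: \<tau>_def)
    then show "int 2 \<le> \<bar>r (\<phi> u) - r (\<phi> v)\<bar>" "\<bar>r (\<phi> u) - r (\<phi> v)\<bar> \<le> int 6 - int 2" by simp_all
  next
    fix u v assume "{u, v} \<in> E \<and> \<sigma> {u, v} = Neg"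
    then show "\<bar>r (\<phi> u) - r (\<phi> v)\<bar> \<le> int 6 div 2 - int 2 \<or> int 6 div 2 + int 2 \<le> \<bar>r (\<phi> u) - r (\<phi> v)\<bar>"
      using r(2)[of "\<phi> v" "\<phi> u"] edge[of u v] by (simp add: \<tau>_def)
  qed simp_all
  then show ?thesis unfolding circular_3_colorable_def by blast
qed


section \<open>Cycles and forests\<close>

fun path_edges :: "'a list \<Rightarrow> 'a set set" where
  "path_edges (a # b # r) = insert {a, b} (path_edges (b # r))"
| "path_edges _ = {}"

lemma path_edges_conv_nth: "path_edges p = {{p ! i, p ! Suc i} | i. Suc i < length p}"
proof (induction p rule: path_edges.induct)
  case (1 a b r)
  have "{{(a # b # r) ! i, (a # b # r) ! Suc i} | i. Suc i < length (a # b # r)} =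
      insert {a, b} {{(b # r) ! i, (b # r) ! Suc i} | i. Suc i < length (b # r)}" (is "?l = ?r")
  proof (intro equalityI subsetI)
    fix e assume "e \<in> ?l"
    then obtain i where "Suc i < length (a # b # r)" "e = {(a # b # r) ! i, (a # b # r) ! Suc i}" by blast
    then show "e \<in> ?r" by (cases i) auto
  next
    fix e assume "e \<in> ?r"
    then consider "e = {a, b}"
      | i where "Suc i < length (b # r)" "e = {(b # r) ! i, (b # r) ! Suc i}" by blast
    then show "e \<in> ?l"
    proof cases
      case 1
      then show ?thesis by (intro CollectI exI[of _ 0]) simp
    next
      case (2 i)
      then show ?thesis by (intro CollectI exI[of _ "Suc i"]) simp
    qed
  qed
  then show ?case using 1 by simp
qed auto

lemma path_edges_subset: "e \<in> path_edges p \<Longrightarrow> e \<subseteq> set p"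
  by (induction p rule: path_edges.induct) auto

text \<open>These are the edges that are not bridges. They are described by the remaining path p
  because its drawing is the arc that completes e to a closed curve.\<close>

definition cycle_edge :: "'a set set \<Rightarrow> 'a set \<Rightarrow> bool" where
  "cycle_edge E e \<longleftrightarrow> e \<in> E \<and>
     (\<exists>p. distinct p \<and> 3 \<le> length p \<and> path_edges p \<subseteq> E - {e} \<and> e = {hd p, last p})"

lemma cycle_edge_mono: "cycle_edge D e \<Longrightarrow> D \<subseteq> E \<Longrightarrow> cycle_edge E e"
  unfolding cycle_edge_def by blast

text \<open>Rotating by \<open>Suc i\<close> makes the chosen edge the closing one; the rotated list
  is then the path.\<close>

lemma graph_cycle_imp_cycle_edge:
  assumes c: "graph_cycle E c" and i: "i < length c"
  shows "cycle_edge E {c ! i, c ! (Suc i mod length c)}"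
proof -
  let ?n = "length c" and ?e = "{c ! i, c ! (Suc i mod length c)}" and ?p = "rotate (Suc i) c"
  have n: "3 \<le> ?n" and dist: "distinct c"
    and edge: "\<And>i. i < ?n \<Longrightarrow> {c ! i, c ! (Suc i mod ?n)} \<in> E"
    using c by (auto simp: graph_cycle_def)
  have ne: "c \<noteq> []" and pos: "0 < ?n" using n by auto
  have nth: "?p ! j = c ! ((Suc i + j) mod ?n)" if "j < ?n" for j
    using that by (simp add: nth_rotate del: rotate_Suc)
  have hd: "hd ?p = ?p ! 0" and last: "last ?p = ?p ! (?n - 1)"
    using ne by (simp_all add: hd_conv_nth last_conv_nth del: rotate_Suc)
  have e: "?e = {hd ?p, last ?p}"
  proof -
    have "Suc i + (?n - 1) = i + ?n" using n by simp
    then have "last ?p = c ! i" unfolding last using nth[of "?n - 1"] i n by simp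
    moreover have "hd ?p = c ! (Suc i mod ?n)" unfolding hd using nth[of 0] n ne
      by (simp del: rotate_Suc)
    ultimately show ?thesis by (simp only: insert_commute)
  qed
  have "path_edges ?p \<subseteq> E - {?e}"
  proof
    fix f assume "f \<in> path_edges ?p"
    then obtain j where j: "Suc j < ?n" "f = {?p ! j, ?p ! Suc j}"
      by (auto simp: path_edges_conv_nth simp del: rotate_Suc)
    have "Suc ((Suc i + j) mod ?n) mod ?n = (Suc i + Suc j) mod ?n" by (simp add: mod_Suc_eq)
    then have "f = {c ! ((Suc i + j) mod ?n), c ! (Suc ((Suc i + j) mod ?n) mod ?n)}"
      using j nth[of j] nth[of "Suc j"] by simp
    then have "f \<in> E" using edge[OF mod_less_divisor[OF pos]] by simp
    moreover have "f \<noteq> ?e"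
    proof
      assume "f = ?e"
      then have "{?p ! j, ?p ! Suc j} = {?p ! 0, ?p ! (?n - 1)}" using j e hd last by simp
      moreover have "distinct ?p" using dist by simp
      ultimately show False
        using j n ne nth_eq_iff_index_eq[of ?p j 0] nth_eq_iff_index_eq[of ?p "Suc j" 0]
          nth_eq_iff_index_eq[of ?p "Suc j" "?n - 1"]
        by (auto simp: doubleton_eq_iff simp del: rotate_Suc)
    qed
    ultimately show "f \<in> E - {?e}" by blast
  qed
  moreover have "distinct ?p" "3 \<le> length ?p" using dist n by simp_all
  ultimately show ?thesis unfolding cycle_edge_def using e edge[OF i] by blast
qed

lemma card_cycle_edges:
  assumes "graph_cycle D c" "D \<subseteq> E" "finite E"
  shows "length c \<le> card {e \<in> D. cycle_edge E e}"
proof -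
  let ?n = "length c" and ?f = "\<lambda>i. {c ! i, c ! (Suc i mod length c)}"
  have n: "3 \<le> ?n" and dist: "distinct c" using assms by (auto simp: graph_cycle_def)
  have "inj_on ?f {..<?n}"
  proof (intro inj_onI)
    fix i j assume ij: "i \<in> {..<?n}" "j \<in> {..<?n}" "?f i = ?f j"
    moreover have "0 < ?n" using n by linarith
    then have "Suc i mod ?n < ?n" "Suc j mod ?n < ?n" by simp_all
    ultimately have "i = j \<or> (i = Suc j mod ?n \<and> j = Suc i mod ?n)"
      using dist by (auto simp: doubleton_eq_iff nth_eq_iff_index_eq)
    \<comment> \<open>If i and j were successors of each other modulo the length, the length would
      divide 2.\<close>
    then show "i = j" using ij n by (auto simp: mod_Suc split: if_splits)
  qed
  then have "?n = card (?f ` {..<?n})" by (simp add: card_image)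
  also have "\<dots> \<le> card {e \<in> D. cycle_edge E e}"
  proof (rule card_mono)
    show "finite {e \<in> D. cycle_edge E e}" using assms(2,3) finite_subset[of _ E] by auto
    show "?f ` {..<?n} \<subseteq> {e \<in> D. cycle_edge E e}"
      using assms graph_cycle_imp_cycle_edge[OF assms(1)] cycle_edge_mono
      by (fastforce simp: graph_cycle_def)
  qed
  finally show ?thesis .
qed

lemma new_cycle_edge:
  assumes "graph_cycle (insert e D) c" "\<nexists>c. graph_cycle D c"
  shows "cycle_edge (insert e D) e"
proof -
  obtain i where "i < length c" "{c ! i, c ! (Suc i mod length c)} = e"
    using assms unfolding graph_cycle_def by blast
  then show ?thesis using graph_cycle_imp_cycle_edge[OF assms(1)] by metis
qed

text \<open>The first vertex of a longest path is a leaf: a further edge there would lengthen the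
  path or, leading back into it, close a cycle.\<close>

lemma acyclic_leaf:
  assumes fin: "finite E" and two: "\<And>e. e \<in> E \<Longrightarrow> card e = 2" and "E \<noteq> {}"
    and acyclic: "\<nexists>c. graph_cycle E c"
  obtains a b where "{a, b} \<in> E" "a \<noteq> b" "\<And>e. e \<in> E \<Longrightarrow> a \<in> e \<Longrightarrow> e = {a, b}"
proof -
  define P where "P p \<longleftrightarrow> distinct p \<and> 2 \<le> length p \<and> path_edges p \<subseteq> E" for p
  obtain x y where "{x, y} \<in> E" "x \<noteq> y"
    using \<open>E \<noteq> {}\<close> two by (metis all_not_in_conv card_2_iff)
  then have P0: "P [x, y]" by (simp add: P_def)
  have finU: "finite (\<Union>E)" using fin two by (metis card.infinite finite_Union zero_neq_numeral)
  have bound: "length p < Suc (card (\<Union>E))" if "P p" for p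
  proof -
    have "set p \<subseteq> \<Union>E"
    proof
      fix v assume "v \<in> set p"
      then obtain i where i: "i < length p" "v = p ! i" by (auto simp: in_set_conv_nth)
      have edges: "{p ! j, p ! Suc j} \<in> E" if "Suc j < length p" for j
        using \<open>P p\<close> that unfolding P_def path_edges_conv_nth by blast
      show "v \<in> \<Union>E"
      proof (cases "Suc i < length p")
        case True
        then show ?thesis using edges[of i] i by blast
      next
        case False
        then have "Suc (i - 1) = i" using i \<open>P p\<close> by (auto simp: P_def)
        then show ?thesis using edges[of "i - 1"] i by auto
      qed
    qed
    then have "card (set p) \<le> card (\<Union>E)" using finU by (rule card_mono[rotated])
    then show ?thesis using that by (simp add: P_def distinct_card)
  qed
  obtain p where p: "P p" and max: "\<And>q. P q \<Longrightarrow> length q \<le> length p"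
    using ex_has_greatest_nat[of P "[x, y]" length, OF P0] bound by blast
  obtain a b r where abr: "p = a # b # r"
    using p unfolding P_def by (metis One_nat_def Suc_1 Suc_le_length_iff)
  have "e = {a, b}" if e: "e \<in> E" "a \<in> e" for e
  proof (rule ccontr)
    assume ne: "e \<noteq> {a, b}"
    obtain w where w: "e = {a, w}" "w \<noteq> a"
      using two[OF e(1)] e(2) by (auto simp: card_2_iff)
    show False
    proof (cases "w \<in> set p")
      case False
      then have "P (w # p)" using p e w by (auto simp: P_def abr insert_commute)
      then show False using max by fastforce
    next
      case True
      then obtain i where i: "i < length p" "w = p ! i" by (auto simp: in_set_conv_nth)
      have "i \<noteq> 0" "i \<noteq> 1" using i w ne abr by auto
      then have i2: "2 \<le> i" by simp
      have "graph_cycle E (take (Suc i) p)"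
        unfolding graph_cycle_def
      proof (intro conjI allI impI)
        show "3 \<le> length (take (Suc i) p)" using i i2 by simp
        show "distinct (take (Suc i) p)" using p by (simp add: P_def)
        fix j assume j: "j < length (take (Suc i) p)"
        show "{take (Suc i) p ! j, take (Suc i) p ! (Suc j mod length (take (Suc i) p))} \<in> E"
        proof (cases "j = i")
          case True
          moreover have "p ! 0 = a" using abr by simp
          ultimately show ?thesis using i e w by (simp add: insert_commute min_absorb2)
        next
          case False
          then have "Suc j < length p" "j < i" using j i by auto
          then have "{p ! j, p ! Suc j} \<in> E" using p unfolding P_def path_edges_conv_nth by blast
          then show ?thesis using i \<open>j < i\<close> by (simp add: min_absorb2)
        qed
      qed
      then show False using acyclic by blast
    qed
  qed
  moreover have "{a, b} \<in> E" "a \<noteq> b" using p abr by (auto simp: P_def)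
  ultimately show thesis using that by blast
qed

lemma card_acyclic:
  assumes "finite_graph V E" "\<nexists>c. graph_cycle E c" "V \<noteq> {}"
  shows "card E + 1 \<le> card V"
  using assms
proof (induction "card E" arbitrary: V E)
  case 0
  have "finite E"
    using 0(2) by (auto simp: finite_graph_def intro: finite_subset[of E "Pow V"])
  then show ?case using 0 by (auto simp: finite_graph_def Suc_le_eq card_gt_0_iff)
next
  case (Suc n)
  have finE: "finite E" "E \<noteq> {}" using Suc(2) by (auto intro: card_ge_0_finite)
  have two: "\<And>e. e \<in> E \<Longrightarrow> card e = 2" using Suc(3) by (simp add: finite_graph_def)
  obtain a b where ab: "{a, b} \<in> E" "a \<noteq> b" "\<And>e. e \<in> E \<Longrightarrow> a \<in> e \<Longrightarrow> e = {a, b}"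
    using acyclic_leaf[OF finE(1) two finE(2) Suc(4)] by blast
  have V: "a \<in> V" "b \<in> V" "finite V" using ab(1) Suc(3) by (auto simp: finite_graph_def)
  have "n = card (E - {{a, b}})" using Suc(2) ab(1) finE by simp
  moreover have "finite_graph (V - {a}) (E - {{a, b}})"
    using Suc(3) ab(3) by (auto simp: finite_graph_def)
  moreover have "\<nexists>c. graph_cycle (E - {{a, b}}) c"
    using Suc(4) unfolding graph_cycle_def by blast
  moreover have "V - {a} \<noteq> {}" using V ab(2) by blast
  ultimately have "card (E - {{a, b}}) + 1 \<le> card (V - {a})" using Suc(1) by blast
  then show ?case using V finE ab(1) by (simp add: card_Diff_singleton)
qed


section \<open>Drawings in the plane\<close>

definition drawn :: "'a set \<Rightarrow> 'a set set \<Rightarrow> ('a \<Rightarrow> 'b) \<Rightarrow> ('a set \<Rightarrow> real \<Rightarrow> 'b) \<Rightarrow> 'b set" where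
  "drawn V E f g = f ` V \<union> (\<Union>e\<in>E. g e ` {0..1})"

lemma drawn_insert: "drawn V (insert e E) f g = drawn V E f g \<union> g e ` {0..1}"
  by (auto simp: drawn_def)

lemma graph_drawing_subset:
  assumes "graph_drawing X V E f g" "V' \<subseteq> V" "E' \<subseteq> E"
  shows "graph_drawing X V' E' f g"
  unfolding graph_drawing_def
proof (intro conjI ballI impI)
  show "inj_on f V'" "f ` V' \<subseteq> topspace X"
    using assms inj_on_subset[of f V V'] by (auto simp: graph_drawing_def)
next
  fix e assume "e \<in> E'"
  then have "e \<in> E" using assms(3) by blast
  then show "pathin X (g e)" "inj_on (g e) {0..1}" "{g e 0, g e 1} = f ` e"
    using assms(1) by (simp_all add: graph_drawing_def)
  have "g e ` {0<..<1} \<inter> f ` V = {}" using assms(1) \<open>e \<in> E\<close> by (simp add: graph_drawing_def)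
  then show "g e ` {0<..<1} \<inter> f ` V' = {}" using assms(2) by blast
next
  fix e e' assume "e \<in> E'" "e' \<in> E'" "e \<noteq> e'"
  then have "e \<in> E" "e' \<in> E" using assms(3) by auto
  then show "g e ` {0<..<1} \<inter> g e' ` {0<..<1} = {}"
    using assms(1) \<open>e \<noteq> e'\<close> by (simp add: graph_drawing_def)
qed

lemma finite_graph_subset:
  assumes "finite_graph V E" "E' \<subseteq> E"
  shows "finite_graph V E'"
  using assms by (auto simp: finite_graph_def)

lemma finite_graph_finite_edges: "finite_graph V E \<Longrightarrow> finite E"
  by (auto simp: finite_graph_def intro: finite_subset[of E "Pow V"])

lemma unit_interval_split: "{0..1 :: real} = {0<..<1} \<union> {0, 1}"
  by auto

lemma edge_image:
  assumes "graph_drawing X V E f g" "e \<in> E"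
  shows "g e ` {0..1} = g e ` {0<..<1} \<union> f ` e"
proof -
  have "{g e 0, g e 1} = f ` e" using assms by (simp add: graph_drawing_def)
  then show ?thesis unfolding unit_interval_split by auto
qed

lemma edge_image_Int:
  assumes d: "graph_drawing X V E f g" and G: "finite_graph V E"
    and e: "e \<in> E" "e' \<in> E" "e \<noteq> e'"
  shows "g e ` {0..1} \<inter> g e' ` {0..1} \<subseteq> f ` (e \<inter> e')"
proof -
  have V: "e \<subseteq> V" "e' \<subseteq> V" using e G by (auto simp: finite_graph_def)
  have "g e ` {0<..<1} \<inter> g e' ` {0<..<1} = {}" "g e ` {0<..<1} \<inter> f ` V = {}"
    "g e' ` {0<..<1} \<inter> f ` V = {}"
    using d e by (auto simp: graph_drawing_def)
  then have "g e ` {0..1} \<inter> g e' ` {0..1} \<subseteq> f ` e \<inter> f ` e'"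
    using V unfolding edge_image[OF d e(1)] edge_image[OF d e(2)] by blast
  also have "\<dots> = f ` (e \<inter> e')"
    using d V inj_on_image_Int[of f V e e'] by (simp add: graph_drawing_def)
  finally show ?thesis .
qed

lemma edge_interior_avoids:
  assumes d: "graph_drawing X V E f g" and G: "finite_graph V E" and e: "e \<in> E" "E' \<subseteq> E - {e}"
  shows "g e ` {0<..<1} \<inter> drawn V E' f g = {}"
proof -
  have "g e ` {0<..<1} \<inter> f ` V = {}" using d e by (auto simp: graph_drawing_def)
  moreover have "g e ` {0<..<1} \<inter> g e' ` {0..1} = {}" if "e' \<in> E'" for e'
  proof -
    have e': "e' \<in> E" "e' \<noteq> e" using that e by auto
    then have "g e ` {0<..<1} \<inter> g e' ` {0<..<1} = {}"
      using d e by (simp add: graph_drawing_def)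
    moreover have "e' \<subseteq> V" using e' G by (simp add: finite_graph_def)
    ultimately show ?thesis
      using \<open>g e ` {0<..<1} \<inter> f ` V = {}\<close> unfolding edge_image[OF d e'(1)] by blast
  qed
  ultimately show ?thesis unfolding drawn_def by blast
qed

text \<open>The plane is \<open>complex\<close>, the type for which \<open>Jordan_curve\<close> and
  \<open>Janiszewski\<close> are stated.\<close>

locale plane_drawing =
  fixes V :: "'a set" and E :: "'a set set" and f :: "'a \<Rightarrow> complex" and g :: "'a set \<Rightarrow> real \<Rightarrow> complex"
  assumes graph: "finite_graph V E" and drawing: "graph_drawing euclidean V E f g"
begin

lemma finV: "finite V" and finE: "finite E"
  using graph finite_graph_finite_edges by (auto simp: finite_graph_def)

lemma edge: "e \<in> E \<Longrightarrow> e \<subseteq> V" "e \<in> E \<Longrightarrow> card e = 2"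
  using graph by (auto simp: finite_graph_def)

lemma arc_edge: "e \<in> E \<Longrightarrow> arc (g e)"
  using drawing by (auto simp: graph_drawing_def arc_def pathin_def path_def)

lemma compact_edge: "e \<in> E \<Longrightarrow> compact (g e ` {0..1})"
  using compact_arc_image[OF arc_edge] by (simp add: path_image_def)

lemma compact_drawn: "E' \<subseteq> E \<Longrightarrow> compact (drawn V E' f g)"
  unfolding drawn_def using finV finite_subset[OF _ finE, of E'] compact_edge
  by (intro compact_Un[OF finite_imp_compact compact_UN]) auto

lemma connected_edge_interior: "e \<in> E \<Longrightarrow> connected (g e ` {0<..<1})"
  using arc_edge[of e]
  by (intro connected_continuous_image) (auto simp: arc_def path_def intro: continuous_on_subset)

lemma directed_edge:
  assumes "{a, b} \<in> E"
  obtains \<gamma> where "arc \<gamma>" "pathstart \<gamma> = f a" "pathfinish \<gamma> = f b" "path_image \<gamma> = g {a, b} ` {0..1}"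
proof -
  let ?g = "g {a, b}"
  have "{?g 0, ?g 1} = {f a, f b}" using drawing assms by (auto simp: graph_drawing_def)
  then consider "?g 0 = f a" "?g 1 = f b" | "?g 0 = f b" "?g 1 = f a"
    by (auto simp: doubleton_eq_iff)
  then show thesis
  proof cases
    case 1
    then show ?thesis using that[of ?g] arc_edge[OF assms]
      by (simp add: pathstart_def pathfinish_def path_image_def)
  next
    case 2
    then show ?thesis using that[of "reversepath ?g"] arc_edge[OF assms] path_image_reversepath[of ?g]
      by (simp add: pathstart_def pathfinish_def path_image_def reversepath_def arc_reversepath[unfolded reversepath_def])
  qed
qed

text \<open>As p is distinct, a lies on no later edge, so the first arc meets the rest of the path
  only at \<open>f b\<close> and the join is again an arc.\<close>

lemma arc_of_path:
  assumes "distinct p" "2 \<le> length p" "path_edges p \<subseteq> E"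
  shows "\<exists>\<gamma>. arc \<gamma> \<and> pathstart \<gamma> = f (hd p) \<and> pathfinish \<gamma> = f (last p) \<and>
    path_image \<gamma> = (\<Union>e\<in>path_edges p. g e ` {0..1})"
  using assms
proof (induction p rule: path_edges.induct)
  case (1 a b r)
  have ab: "{a, b} \<in> E" using 1 by simp
  obtain \<delta> where \<delta>: "arc \<delta>" "pathstart \<delta> = f a" "pathfinish \<delta> = f b" "path_image \<delta> = g {a, b} ` {0..1}"
    using directed_edge[OF ab] .
  show ?case
  proof (cases "r = []")
    case True
    then show ?thesis using \<delta> by auto
  next
    case False
    then have "2 \<le> length (b # r)" by (cases r) auto
    then obtain \<gamma> where \<gamma>: "arc \<gamma>" "pathstart \<gamma> = f b" "pathfinish \<gamma> = f (last (b # r))"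
      "path_image \<gamma> = (\<Union>e\<in>path_edges (b # r). g e ` {0..1})"
      using 1 by auto
    have "path_image \<delta> \<inter> path_image \<gamma> \<subseteq> {pathstart \<gamma>}"
    proof -
      have "g {a, b} ` {0..1} \<inter> g e ` {0..1} \<subseteq> {f b}" if e: "e \<in> path_edges (b # r)" for e
      proof -
        have "a \<notin> e" using path_edges_subset[OF e] 1(2) by auto
        then have "{a, b} \<noteq> e" "{a, b} \<inter> e \<subseteq> {b}" by auto
        then show ?thesis using edge_image_Int[OF drawing graph ab, of e] e 1(4) by auto
      qed
      then show ?thesis unfolding \<delta> \<gamma> by blast
    qed
    then have "arc (\<delta> +++ \<gamma>)" using \<delta> \<gamma> by (intro arc_join) auto
    moreover have "path_image (\<delta> +++ \<gamma>) = (\<Union>e\<in>path_edges (a # b # r). g e ` {0..1})"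
      using \<delta> \<gamma> by (subst path_image_join) auto
    ultimately show ?thesis using \<delta> \<gamma> by (intro exI[of _ "\<delta> +++ \<gamma>"]) simp
  qed
qed auto

text \<open>The complementary arc \<open>\<gamma>\<close> is returned together with J: it is the
  part of J that remains when e is erased from the drawing.\<close>

lemma closed_curve_through_edge:
  assumes "cycle_edge E e"
  obtains J \<gamma> where "simple_path J" "pathfinish J = pathstart J" "arc \<gamma>"
    "path_image J = path_image \<gamma> \<union> g e ` {0..1}" "f ` e \<subseteq> path_image \<gamma>"
    "path_image \<gamma> \<inter> g e ` {0<..<1} = {}" "path_image \<gamma> \<subseteq> drawn V (E - {e}) f g"
proof -
  obtain p where e: "e \<in> E" "e = {hd p, last p}" and p: "distinct p" "3 \<le> length p" "path_edges p \<subseteq> E - {e}"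
    using assms by (auto simp: cycle_edge_def)
  obtain \<gamma> where \<gamma>: "arc \<gamma>" "pathstart \<gamma> = f (hd p)" "pathfinish \<gamma> = f (last p)"
    "path_image \<gamma> = (\<Union>e\<in>path_edges p. g e ` {0..1})"
    using arc_of_path[of p] p by auto
  obtain \<delta> where \<delta>: "arc \<delta>" "pathstart \<delta> = f (last p)" "pathfinish \<delta> = f (hd p)" "path_image \<delta> = g e ` {0..1}"
    using directed_edge[of "last p" "hd p"] e by (metis insert_commute)
  have sub: "path_image \<gamma> \<subseteq> drawn V (E - {e}) f g" using \<gamma> p by (auto simp: drawn_def)
  then have int: "path_image \<gamma> \<inter> g e ` {0<..<1} = {}"
    using edge_interior_avoids[OF drawing graph e(1), of "E - {e}"] by blast
  have "path_image \<gamma> \<inter> path_image \<delta> \<subseteq> {pathstart \<gamma>, pathstart \<delta>}"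
    using int e(2) unfolding \<delta>(2,4) \<gamma>(2) edge_image[OF drawing e(1)] by auto
  then have "simple_path (\<gamma> +++ \<delta>)" using \<gamma> \<delta> by (intro simple_path_join_loop) auto
  moreover have "path_image (\<gamma> +++ \<delta>) = path_image \<gamma> \<union> g e ` {0..1}"
    using \<gamma> \<delta> by (subst path_image_join) auto
  moreover have "f ` e \<subseteq> path_image \<gamma>"
    using e(2) \<gamma>(2,3) pathstart_in_path_image[of \<gamma>] pathfinish_in_path_image[of \<gamma>] by auto
  ultimately show thesis using that[of "\<gamma> +++ \<delta>" \<gamma>] \<gamma> \<delta> int sub by simp
qed

end

lemma plane_drawing_subset:
  "plane_drawing V E f g \<Longrightarrow> E' \<subseteq> E \<Longrightarrow> plane_drawing V E' f g"
  unfolding plane_drawing_def using finite_graph_subset graph_drawing_subset by blast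

text \<open>A leaf edge meets the rest of the forest in a single point, so by Janiszewski's theorem
  adding it does not separate the plane.\<close>

lemma connected_complement_forest:
  assumes "plane_drawing V E f g" "\<nexists>c. graph_cycle E c"
  shows "connected (- drawn V E f g)"
  using assms
proof (induction "card E" arbitrary: V E)
  case 0
  interpret plane_drawing V E f g by fact
  have "E = {}" using 0 finE by simp
  then have "- drawn V E f g = UNIV - f ` V" by (auto simp: drawn_def)
  then show ?case
    using finV connected_open_delete_finite[of "UNIV :: complex set" "f ` V"]
      convex_connected[OF convex_UNIV] by simp
next
  case (Suc n)
  interpret plane_drawing V E f g by fact
  have "E \<noteq> {}" using Suc(2) by auto
  then obtain a b where ab: "{a, b} \<in> E" "a \<noteq> b" "\<And>e. e \<in> E \<Longrightarrow> a \<in> e \<Longrightarrow> e = {a, b}"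
    using acyclic_leaf[OF finE edge(2) _ Suc(4)] by metis
  \<comment> \<open>The leaf vertex is removed along with its edge; with \<open>f a\<close> kept,
    the edge would meet the rest in two points, a disconnected set.\<close>
  let ?E = "E - {{a, b}}" and ?V = "V - {a}"
  have V: "a \<in> V" "b \<in> V" using edge(1)[OF ab(1)] by auto
  have G': "finite_graph ?V ?E" using graph ab(3) by (auto simp: finite_graph_def)
  have d': "plane_drawing ?V ?E f g"
    using G' graph_drawing_subset[OF drawing, of ?V ?E] by (auto simp: plane_drawing_def)
  interpret D': plane_drawing ?V ?E f g by fact
  have "\<nexists>c. graph_cycle ?E c" using Suc(4) unfolding graph_cycle_def by blast
  then have con: "connected (- drawn ?V ?E f g)" using Suc(1)[OF _ d'] Suc(2) ab(1) finE by simp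
  have eq: "drawn V E f g = drawn ?V ?E f g \<union> g {a, b} ` {0..1}"
  proof -
    have "drawn V E f g = drawn V ?E f g \<union> g {a, b} ` {0..1}"
      using drawn_insert[of V "{a, b}" ?E f g] ab(1) by (simp add: insert_absorb)
    moreover have "drawn V ?E f g = insert (f a) (drawn ?V ?E f g)" using V by (auto simp: drawn_def)
    moreover have "f a \<in> g {a, b} ` {0..1}" unfolding edge_image[OF drawing ab(1)] by simp
    ultimately show ?thesis by (simp add: insert_absorb)
  qed
  have "drawn ?V ?E f g \<inter> g {a, b} ` {0..1} = {f b}"
  proof
    have "f ` ?V \<inter> g {a, b} ` {0..1} \<subseteq> {f b}"
    proof -
      have "g {a, b} ` {0<..<1} \<inter> f ` V = {}" "inj_on f V"
        using drawing ab(1) by (auto simp: graph_drawing_def)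
      then show ?thesis using V unfolding edge_image[OF drawing ab(1)] by (auto simp: inj_on_def)
    qed
    moreover have "g e ` {0..1} \<inter> g {a, b} ` {0..1} \<subseteq> {f b}" if e: "e \<in> ?E" for e
    proof -
      have "a \<notin> e" using ab(3) e by blast
      then have "e \<inter> {a, b} \<subseteq> {b}" by auto
      then show ?thesis using edge_image_Int[OF drawing graph _ ab(1), of e] e by blast
    qed
    ultimately show "drawn ?V ?E f g \<inter> g {a, b} ` {0..1} \<subseteq> {f b}" unfolding drawn_def by blast
    show "{f b} \<subseteq> drawn ?V ?E f g \<inter> g {a, b} ` {0..1}"
      using V ab(2) edge_image[OF drawing ab(1)] by (auto simp: drawn_def)
  qed
  moreover have "connected (- (g {a, b} ` {0..1}))"
    using connected_arc_complement[OF arc_edge[OF ab(1)]] by (simp add: path_image_def)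
  ultimately show ?case
    unfolding eq using con D'.compact_drawn[of ?E] compact_edge[OF ab(1)]
    by (intro Janiszewski_connected compact_imp_closed) auto
qed

section \<open>Faces of a plane drawing and the edges on their boundary\<close>

context plane_drawing
begin

abbreviation D :: "complex set" where
  "D \<equiv> drawn V E f g"

text \<open>A face is given by any of its points x. Contact at an end of e does not count: many
  faces may meet at a vertex, but only two along an edge of a cycle.\<close>

definition touches :: "complex \<Rightarrow> 'a set \<Rightarrow> bool" where
  "touches x e \<longleftrightarrow> closure (connected_component_set (- D) x) \<inter> g e ` {0<..<1} \<noteq> {}"

text \<open>Two faces that touch \<open>e\<close> and lie on the same side of a closed curve \<open>J\<close> through \<open>e\<close> are equal:
  neither \<open>J\<close> nor the drawing without \<open>e\<close> separates them, and these two sets meet in an arc.\<close>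

lemma same_face:
  assumes e: "e \<in> E" and J: "simple_path J" "path_image J = path_image \<gamma> \<union> g e ` {0..1}"
    and \<gamma>: "arc \<gamma>" "f ` e \<subseteq> path_image \<gamma>" "path_image \<gamma> \<inter> g e ` {0<..<1} = {}"
      "path_image \<gamma> \<subseteq> drawn V (E - {e}) f g"
    and touch: "touches x e" "touches y e"
    and side: "connected_component (- path_image J) x y"
  shows "connected_component (- D) x y"
proof -
  let ?T = "drawn V (E - {e}) f g" and ?I = "g e ` {0<..<1}"
  have eq: "D = path_image J \<union> ?T"
    using drawn_insert[of V e "E - {e}" f g] e \<gamma>(4) unfolding J(2) by (auto simp: insert_absorb)
  have clT: "closed ?T" using compact_drawn[of "E - {e}"] by (auto intro: compact_imp_closed)
  have IT: "?I \<subseteq> - ?T"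
    using edge_interior_avoids[OF drawing graph e, of "E - {e}"] by blast
  \<comment> \<open>Once e is erased, a face that touches e reaches the interior of e: a small ball
    around the point of contact avoids the rest of the drawing.\<close>
  have near: "\<exists>p\<in>?I. connected_component (- ?T) z p" if z: "touches z e" for z
  proof -
    obtain p where p: "p \<in> closure (connected_component_set (- D) z)" "p \<in> ?I"
      using z by (auto simp: touches_def)
    have "open (- ?T)" "p \<in> - ?T" using clT IT p(2) by (auto simp: open_Compl)
    then obtain \<epsilon> where \<epsilon>: "\<epsilon> > 0" "ball p \<epsilon> \<subseteq> - ?T"
      by (meson open_contains_ball)
    obtain w where w: "w \<in> connected_component_set (- D) z" "dist w p < \<epsilon>"
      using p(1) \<epsilon>(1) closure_approachable by blast
    have "connected_component (- ?T) z w"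
      using w(1) connected_component_of_subset[of "- D" z w "- ?T"] eq by auto
    moreover have "connected_component (- ?T) w p"
      using \<epsilon> w(2) connected_component_def[of "- ?T" w p] connected_ball[of p \<epsilon>]
      by (auto simp: dist_commute intro: exI[of _ "ball p \<epsilon>"])
    ultimately show ?thesis using p(2) connected_component_trans by blast
  qed
  obtain p q where pq: "p \<in> ?I" "connected_component (- ?T) x p" "q \<in> ?I" "connected_component (- ?T) y q"
    using near touch by blast
  have "connected_component (- ?T) p q"
    unfolding connected_component_def using pq IT connected_edge_interior[OF e] by blast
  then have T: "connected_component (- ?T) x y"
    using pq by (meson connected_component_sym connected_component_trans)
  have "path_image J \<inter> ?T = path_image \<gamma>"
    using IT \<gamma>(2,4) unfolding J(2) edge_image[OF drawing e] by blast
  then have "connected (path_image J \<inter> ?T)" using \<gamma>(1) connected_arc_image by simp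
  then show ?thesis
    unfolding eq using J(1) clT side T by (intro Janiszewski compact_simple_path_image)
qed

text \<open>The closed curve through e has two sides, so two of the three points lie on the same
  side, and \<open>same_face\<close> applies to them.\<close>

lemma touching_faces:
  assumes "cycle_edge E e" and touch: "touches x e" "touches y e" "touches z e"
    and "x \<notin> D" "y \<notin> D" "z \<notin> D"
  shows "connected_component (- D) x y \<or> connected_component (- D) x z \<or> connected_component (- D) y z"
proof -
  have e: "e \<in> E" using assms(1) by (simp add: cycle_edge_def)
  obtain J \<gamma> where J: "simple_path J" "pathfinish J = pathstart J" "path_image J = path_image \<gamma> \<union> g e ` {0..1}"
    and \<gamma>: "arc \<gamma>" "f ` e \<subseteq> path_image \<gamma>" "path_image \<gamma> \<inter> g e ` {0<..<1} = {}"
      "path_image \<gamma> \<subseteq> drawn V (E - {e}) f g"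
    using closed_curve_through_edge[OF assms(1)] by metis
  obtain A B where AB: "connected A" "connected B" "A \<union> B = - path_image J"
    using Jordan_curve[OF J(1,2)] by metis
  have "drawn V (E - {e}) f g \<subseteq> D" "g e ` {0..1} \<subseteq> D" using e by (auto simp: drawn_def)
  then have "path_image J \<subseteq> D" using J(3) \<gamma>(4) by blast
  then have "x \<in> A \<union> B" "y \<in> A \<union> B" "z \<in> A \<union> B" using AB(3) assms(5-7) by auto
  moreover have "connected_component (- path_image J) p q"
    if "p \<in> A \<and> q \<in> A \<or> p \<in> B \<and> q \<in> B" for p q
    using that AB unfolding connected_component_def by blast
  ultimately show ?thesis
    using same_face[OF e J(1,3) \<gamma>] touch by blast
qed

text \<open>Were the edges touching the face of x a forest, their complement would be connected. It
  contains x and a point of another face, hence a frontier point w of the face; but w lies on an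
  edge that touches the face.\<close>

lemma face_boundary_cycle:
  assumes "x \<notin> D" "y \<notin> D" "\<not> connected_component (- D) x y"
  shows "\<exists>c. graph_cycle {e \<in> E. touches x e} c"
proof (rule ccontr)
  let ?E = "{e \<in> E. touches x e}" and ?F = "connected_component_set (- D) x"
  assume acyclic: "\<not> ?thesis"
  have "plane_drawing V ?E f g"
    using plane_drawing_subset[of V E f g ?E] plane_drawing_axioms by simp
  then have con: "connected (- drawn V ?E f g)" using connected_complement_forest acyclic by blast
  have sub: "drawn V ?E f g \<subseteq> D" by (auto simp: drawn_def)
  have "x \<in> - drawn V ?E f g \<inter> ?F" "y \<in> - drawn V ?E f g - ?F" using assms sub by auto
  then obtain w where w: "w \<notin> drawn V ?E f g" "w \<in> frontier ?F"
    using connected_Int_frontier[OF con, of ?F] by blast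
  have "closed D" using compact_drawn[of E] compact_imp_closed by blast
  then have "w \<in> D"
    using w(2) frontier_of_connected_component_subset[of "- D" x] frontier_subset_closed[of D] by auto
  then obtain e where e: "e \<in> E" "w \<in> g e ` {0..1}" using w(1) by (auto simp: drawn_def)
  \<comment> \<open>All of V is kept in \<open>drawn V ?E f g\<close>, so w is not a vertex and lies
    in the interior of e.\<close>
  moreover have "w \<notin> f ` e" using w(1) edge(1)[OF e(1)] by (auto simp: drawn_def)
  ultimately have "w \<in> g e ` {0<..<1}" using edge_image[OF drawing e(1)] by blast
  then have "touches x e" using w(2) by (auto simp: touches_def frontier_def)
  then show False using e w(1) by (auto simp: drawn_def)
qed

text \<open>The interior of e lies in one face of the smaller drawing. Close to its midpoint there
  are points on both sides of the Jordan curve through e; they belong to that face and are separated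
  once e is drawn. They replace the point of X in that face.\<close>

lemma split_face:
  assumes E: "E = insert e E'" "e \<notin> E'" and cycle: "cycle_edge E e"
    and X: "finite X" "X \<inter> drawn V E' f g = {}"
      "\<And>x y. x \<in> X \<Longrightarrow> y \<in> X \<Longrightarrow> connected_component (- drawn V E' f g) x y \<Longrightarrow> x = y"
  shows "\<exists>Y. finite Y \<and> card Y = card X + 1 \<and> Y \<inter> D = {} \<and>
      (\<forall>x\<in>Y. \<forall>y\<in>Y. connected_component (- D) x y \<longrightarrow> x = y)"
proof -
  let ?D = "drawn V E' f g" and ?m = "g e (1/2)"
  let ?F = "connected_component_set (- ?D) ?m"
  have e: "e \<in> E" using E by blast
  obtain J \<gamma> where J: "simple_path J" "pathfinish J = pathstart J" "path_image J = path_image \<gamma> \<union> g e ` {0..1}"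
    and \<gamma>: "path_image \<gamma> \<subseteq> drawn V (E - {e}) f g"
    using closed_curve_through_edge[OF cycle] by metis
  have "E - {e} = E'" using E by blast
  then have JD: "path_image J \<subseteq> D" "g e ` {0..1} \<subseteq> path_image J" "D = ?D \<union> g e ` {0..1}"
    using J(3) \<gamma> unfolding E(1) drawn_insert by auto
  have I: "g e ` {0<..<1} \<inter> ?D = {}"
    using edge_interior_avoids[OF drawing graph e, of E'] E by blast
  have mI: "?m \<in> g e ` {0<..<1}" by simp
  have IF: "g e ` {0<..<1} \<subseteq> ?F"
    by (rule connected_component_maximal[OF mI connected_edge_interior[OF e]]) (use I in blast)
  have "closed ?D" using compact_drawn[of E'] E compact_imp_closed by blast
  then have "open (- ?D)" "?m \<in> - ?D" using I mI by (simp add: open_Compl, blast)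
  then obtain \<epsilon> where \<epsilon>: "\<epsilon> > 0" "ball ?m \<epsilon> \<subseteq> - ?D"
    by (meson open_contains_ball)
  have ballF: "ball ?m \<epsilon> \<subseteq> ?F"
    by (rule connected_component_maximal) (use \<epsilon> in auto)
  obtain A B where AB: "open A" "open B" "A \<inter> B = {}" "A \<union> B = - path_image J"
    "frontier A = path_image J" "frontier B = path_image J"
    using Jordan_curve[OF J(1,2)] by metis
  have "?m \<in> path_image J" using JD(2) mI by auto
  then have "?m \<in> closure A" "?m \<in> closure B" using AB(5,6) by (auto simp: frontier_def)
  then obtain p q where p: "p \<in> A" "p \<in> ball ?m \<epsilon>" and q: "q \<in> B" "q \<in> ball ?m \<epsilon>"
    using \<epsilon>(1) closure_approachable by (metis dist_commute mem_ball)
  have pqF: "p \<in> ?F" "q \<in> ?F" using p q ballF by auto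
  have pqD: "p \<notin> D" "q \<notin> D" using p q AB(4) JD \<epsilon>(2) by auto
  have sep: "\<not> connected_component (- D) p q"
  proof
    assume "connected_component (- D) p q"
    then obtain T where T: "connected T" "T \<subseteq> - D" "p \<in> T" "q \<in> T"
      by (auto simp: connected_component_def)
    then have "T \<subseteq> A \<union> B" using AB(4) JD(1) by blast
    then show False using connectedD[OF T(1) AB(1,2)] AB(3) T p(1) q(1) by blast
  qed
  have mono: "connected_component (- ?D) x y" if "connected_component (- D) x y" for x y
    using that connected_component_of_subset[of "- D" x y "- ?D"] JD(3) by blast
  have "card (X \<inter> ?F) \<le> 1"
  proof -
    have "x = y" if "x \<in> X \<inter> ?F" "y \<in> X \<inter> ?F" for x y
    proof -
      have "connected_component (- ?D) x ?m" "connected_component (- ?D) ?m y"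
        using that by (auto intro: connected_component_sym)
      then show ?thesis using X(3) that connected_component_trans by blast
    qed
    then show ?thesis using X(1) by (metis One_nat_def card_le_Suc0_iff_eq finite_Int)
  qed
  moreover have "card X = card (X \<inter> ?F) + card (X - ?F)" using X(1) card_Int_Diff by blast
  moreover have "card (insert p (insert q (X - ?F))) = card (X - ?F) + 2"
  proof -
    have "p \<noteq> q" using p(1) q(1) AB(3) by blast
    then show ?thesis using X(1) pqF by simp
  qed
  \<comment> \<open>X may have no point in the split face, and then the new set is too large by one;
    a subset of the exact size is taken.\<close>
  ultimately have "card X + 1 \<le> card (insert p (insert q (X - ?F)))" by linarith
  then obtain Y where Y: "Y \<subseteq> insert p (insert q (X - ?F))" "card Y = card X + 1"
    using obtain_subset_with_card_n by metis
  have "x \<notin> D" if "x \<in> X - ?F" for x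
  proof -
    have "x \<notin> ?D" "x \<notin> g e ` {0<..<1}" using that X(2) IF by auto
    moreover have "f ` e \<subseteq> ?D" using edge(1)[OF e] by (auto simp: drawn_def)
    ultimately show ?thesis using JD(3) edge_image[OF drawing e] by blast
  qed
  then have "Y \<inter> D = {}" using Y(1) pqD by blast
  moreover have "x = y" if xy: "x \<in> Y" "y \<in> Y" "connected_component (- D) x y" for x y
  proof -
    have c: "connected_component (- ?D) x y" "connected_component (- ?D) y x"
      "connected_component (- D) y x"
      using mono xy(3) by (auto intro: connected_component_sym)
    have F: "y \<in> ?F" if "x \<in> ?F" "connected_component (- ?D) x y" for x y
      using that connected_component_trans by fastforce
    consider "x \<in> X - ?F" "y \<in> X - ?F" | "x \<in> {p, q}" "y \<in> {p, q}"
      | "x \<in> {p, q}" "y \<in> X - ?F" | "y \<in> {p, q}" "x \<in> X - ?F"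
      using xy(1,2) Y(1) by blast
    then show ?thesis
    proof cases
      case 1
      then show ?thesis using X(3) c by blast
    next
      case 2
      then show ?thesis using sep xy(3) c(3) by auto
    next
      case 3
      then show ?thesis using F[OF _ c(1)] pqF by blast
    next
      case 4
      then show ?thesis using F[OF _ c(2)] pqF by blast
    qed
  qed
  moreover have "finite Y" using Y(1) X(1) finite_subset by (metis finite.insertI finite_Diff)
  ultimately show ?thesis using Y(2) by blast
qed

end

text \<open>One point serves for a maximal acyclic T. Each of the other edges closes a cycle with T
  and so splits a face, which yields |E| - |T| + 1 points in distinct faces, and |T| < |V|.\<close>

lemma exists_face_points:
  assumes "plane_drawing V E f g" "V \<noteq> {}"
  shows "\<exists>X. finite X \<and> card E + 2 \<le> card X + card V \<and> X \<inter> drawn V E f g = {} \<and>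
    (\<forall>x\<in>X. \<forall>y\<in>X. connected_component (- drawn V E f g) x y \<longrightarrow> x = y)"
proof -
  interpret plane_drawing V E f g by fact
  define acyclic where "acyclic T \<longleftrightarrow> T \<subseteq> E \<and> (\<nexists>c. graph_cycle T c)" for T :: "'a set set"
  have "\<not> graph_cycle {} c" for c :: "'a list" by (cases c) (auto simp: graph_cycle_def)
  then have "acyclic {}" by (simp add: acyclic_def)
  moreover have "finite {T. acyclic T}"
    using finE by (auto simp: acyclic_def intro: finite_subset[of _ "Pow E"])
  ultimately have "\<exists>T. acyclic T \<and> (\<forall>T'. acyclic T' \<longrightarrow> T \<subseteq> T' \<longrightarrow> T = T')"
    using finite_has_maximal2[of "{T. acyclic T}" "{}"] by simp
  then obtain T where T: "acyclic T" "\<And>T'. acyclic T' \<Longrightarrow> T \<subseteq> T' \<Longrightarrow> T = T'"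
    by metis
  have TE: "T \<subseteq> E" "\<nexists>c. graph_cycle T c" using T(1) by (simp_all add: acyclic_def)
  have cyc: "cycle_edge (insert e T) e" if e: "e \<in> E - T" for e
  proof -
    have "\<not> acyclic (insert e T)" using T(2)[of "insert e T"] that by blast
    then obtain c where "graph_cycle (insert e T) c"
      using TE(1) e unfolding acyclic_def by blast
    then show ?thesis using TE(2) by (rule new_cycle_edge)
  qed
  have "\<exists>X. finite X \<and> card X = card R + 1 \<and> X \<inter> drawn V (T \<union> R) f g = {} \<and>
    (\<forall>x\<in>X. \<forall>y\<in>X. connected_component (- drawn V (T \<union> R) f g) x y \<longrightarrow> x = y)"
    if "finite R" "R \<subseteq> E - T" for R
    using that
  proof (induction R rule: finite_induct)
    case empty
    have "drawn V T f g \<noteq> UNIV" using compact_drawn[OF TE(1)] not_compact_UNIV by metis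
    then obtain x where "x \<notin> drawn V T f g" by blast
    then show ?case by (intro exI[of _ "{x}"]) auto
  next
    case (insert e R)
    let ?E = "T \<union> insert e R" and ?E' = "T \<union> R"
    have "?E \<subseteq> E" using TE(1) insert.prems by blast
    then interpret D': plane_drawing V ?E f g by (rule plane_drawing_subset[OF assms(1)])
    have "R \<subseteq> E - T" using insert.prems by blast
    from insert.IH[OF this] obtain X where X: "finite X" "card X = card R + 1" "X \<inter> drawn V ?E' f g = {}"
      "\<And>x y. x \<in> X \<Longrightarrow> y \<in> X \<Longrightarrow> connected_component (- drawn V ?E' f g) x y \<Longrightarrow> x = y"
      by auto
    have "cycle_edge ?E e" using cycle_edge_mono[OF cyc[of e], of ?E] insert.prems by blast
    moreover have "?E = insert e ?E'" "e \<notin> ?E'" using insert by auto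
    ultimately have "\<exists>Y. finite Y \<and> card Y = card X + 1 \<and> Y \<inter> drawn V ?E f g = {} \<and>
        (\<forall>x\<in>Y. \<forall>y\<in>Y. connected_component (- drawn V ?E f g) x y \<longrightarrow> x = y)"
      using X by (intro D'.split_face[of e ?E'])
    then show ?case using X(2) insert.hyps by simp
  qed
  from this[of "E - T"] obtain X where X: "finite X" "card X = card (E - T) + 1"
    "X \<inter> drawn V (T \<union> (E - T)) f g = {}"
    "\<forall>x\<in>X. \<forall>y\<in>X. connected_component (- drawn V (T \<union> (E - T)) f g) x y \<longrightarrow> x = y"
    using finE by blast
  have "T \<union> (E - T) = E" using TE by blast
  moreover have "card T + 1 \<le> card V"
    using card_acyclic[OF finite_graph_subset[OF graph TE(1)] TE(2) assms(2)] .
  moreover have "card (E - T) = card E - card T" "card T \<le> card E"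
    using TE(1) finE finite_subset card_mono by (auto intro: card_Diff_subset)
  ultimately show ?thesis using X by (intro exI[of _ X]) auto
qed

text \<open>Euler's formula enters only through \<open>F \<ge> |E| - |V| + 2\<close>; every face touches a cycle, hence at
  least six cycle edges, and every cycle edge touches at most two faces.\<close>

theorem planar_girth_6_bound:
  assumes "plane_drawing V E f g" "4 \<le> card V"
    and girth: "\<And>c. graph_cycle E c \<Longrightarrow> 6 \<le> length c"
  shows "2 * card E + 6 \<le> 3 * card V"
proof -
  interpret plane_drawing V E f g by fact
  have "V \<noteq> {}" using assms(2) by auto
  then obtain X where X: "finite X" "card E + 2 \<le> card X + card V" "X \<inter> D = {}"
    "\<forall>x\<in>X. \<forall>y\<in>X. connected_component (- D) x y \<longrightarrow> x = y"
    using exists_face_points[OF assms(1)] by blast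
  show ?thesis
  proof (cases "card X \<le> 1")
    \<comment> \<open>Here |E| < |V|, and 2 (|V| - 1) + 6 \<le> 3 |V| is where four vertices are
      required.\<close>
    case True
    then show ?thesis using X(2) assms(2) by linarith
  next
    case False
    let ?C = "{e \<in> E. cycle_edge E e}"
    have finC: "finite ?C" using finE by simp
    have six: "6 \<le> card {e \<in> ?C. touches x e}" if x: "x \<in> X" for x
    proof -
      have "X \<noteq> {x}" using False by auto
      then obtain y where y: "y \<in> X" "y \<noteq> x" using x by blast
      then have "\<not> connected_component (- D) x y" using X(4) x by blast
      then obtain c where c: "graph_cycle {e \<in> E. touches x e} c"
        using face_boundary_cycle[of x y] x y X(3) by blast
      then have "graph_cycle E c" unfolding graph_cycle_def by blast
      then have "6 \<le> length c" by (rule girth)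
      also have "\<dots> \<le> card {e \<in> {e \<in> E. touches x e}. cycle_edge E e}"
        using card_cycle_edges[OF c _ finE] by blast
      also have "{e \<in> {e \<in> E. touches x e}. cycle_edge E e} = {e \<in> ?C. touches x e}" by blast
      finally show ?thesis .
    qed
    have two: "card {x \<in> X. touches x e} \<le> 2" if e: "e \<in> ?C" for e
    proof (rule ccontr)
      assume "\<not> ?thesis"
      then have "3 \<le> card {x \<in> X. touches x e}" by simp
      then obtain S where S: "S \<subseteq> {x \<in> X. touches x e}" "card S = 3"
        using obtain_subset_with_card_n by metis
      then obtain x y z where "S = {x, y, z}" "x \<noteq> y" "x \<noteq> z" "y \<noteq> z" by (auto simp: card_3_iff)
      then show False
        using touching_faces[of e x y z] S(1) e X(3,4) by blast
    qed
    have "6 * card X = (\<Sum>x\<in>X. 6)" by simp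
    also have "\<dots> \<le> (\<Sum>x\<in>X. card {e \<in> ?C. touches x e})" using six by (intro sum_mono) auto
    also have "\<dots> = (\<Sum>e\<in>?C. card {x \<in> X. touches x e})"
      using X(1) finC by (intro sum_multicount_gen) auto
    also have "\<dots> \<le> (\<Sum>e\<in>?C. 2)" using two by (intro sum_mono) auto
    also have "\<dots> \<le> 2 * card E" using card_mono[OF finE, of ?C] by simp
    \<comment> \<open>From 3 |X| \<le> |E| and |E| + 2 \<le> |X| + |V|, the latter taken three
      times.\<close>
    finally show ?thesis using X(2) by linarith
  qed
qed

section \<open>Transfer of drawings, and the passage from the sphere to the plane\<close>

lemma graph_drawing_in_topspace:
  assumes "graph_drawing X V E f g" "e \<in> E"
  shows "g e ` {0..1} \<subseteq> topspace X"
  using assms path_image_subset_topspace[of X "g e"] by (auto simp: graph_drawing_def)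

lemma graph_drawing_compose:
  assumes d: "graph_drawing X V E f g" and h: "continuous_map X Y h" "inj_on h (topspace X)"
  shows "graph_drawing Y V E (h \<circ> f) (\<lambda>e. h \<circ> g e)"
proof -
  have V: "inj_on f V" "f ` V \<subseteq> topspace X" using d by (auto simp: graph_drawing_def)
  have disj: "h ` A \<inter> h ` B = {}" if "A \<inter> B = {}" "A \<subseteq> topspace X" "B \<subseteq> topspace X" for A B
    using that inj_on_image_Int[OF h(2), of A B] by simp
  show ?thesis
    unfolding graph_drawing_def
  proof (intro conjI ballI impI)
    show "inj_on (h \<circ> f) V" using V h(2) by (intro comp_inj_on) (auto intro: inj_on_subset)
    show "(h \<circ> f) ` V \<subseteq> topspace Y" using V(2) h(1) continuous_map_image_subset_topspace by fastforce
  next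
    fix e assume e: "e \<in> E"
    have sub: "g e ` {0..1} \<subseteq> topspace X" using graph_drawing_in_topspace[OF d e] .
    show "pathin Y (h \<circ> g e)" using d e h(1) by (auto simp: graph_drawing_def intro: pathin_compose)
    show "inj_on (h \<circ> g e) {0..1}"
      using d e h(2) sub by (intro comp_inj_on) (auto simp: graph_drawing_def intro: inj_on_subset)
    have "{g e 0, g e 1} = f ` e" using d e by (simp add: graph_drawing_def)
    then have "h ` {g e 0, g e 1} = h ` f ` e" by simp
    then show "{(h \<circ> g e) 0, (h \<circ> g e) 1} = (h \<circ> f) ` e" by (simp add: image_comp)
    have "g e ` {0<..<1} \<inter> f ` V = {}" using d e by (simp add: graph_drawing_def)
    moreover have "g e ` {0<..<1} \<subseteq> topspace X" using sub by force
    ultimately show "(h \<circ> g e) ` {0<..<1} \<inter> (h \<circ> f) ` V = {}"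
      unfolding image_comp[symmetric] using V(2) by (rule disj)
  next
    fix e e' assume e: "e \<in> E" "e' \<in> E" "e \<noteq> e'"
    then have "g e ` {0<..<1} \<inter> g e' ` {0<..<1} = {}" using d by (simp add: graph_drawing_def)
    moreover have "g e ` {0<..<1} \<subseteq> topspace X" if "e \<in> E" for e
      using graph_drawing_in_topspace[OF d that] by force
    then have "g e ` {0<..<1} \<subseteq> topspace X" "g e' ` {0<..<1} \<subseteq> topspace X" using e by auto
    ultimately show "(h \<circ> g e) ` {0<..<1} \<inter> (h \<circ> g e') ` {0<..<1} = {}"
      unfolding image_comp[symmetric] by (rule disj)
  qed
qed

text \<open>On the interior, k followed by the inverse of the parametrisation is continuous and
  injective from an open set of the plane to the line; invariance of dimension forces this set to be
  empty.\<close>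

lemma interior_vimage_arc_empty:
  fixes k :: "complex \<Rightarrow> 'b :: euclidean_space" and \<gamma> :: "real \<Rightarrow> 'b"
  assumes k: "continuous_on UNIV k" "inj k" and \<gamma>: "continuous_on {0..1} \<gamma>" "inj_on \<gamma> {0..1}"
  shows "interior (k -` (\<gamma> ` {0..1})) = {}"
proof (rule ccontr)
  let ?I = "interior (k -` (\<gamma> ` {0..1}))"
  assume ne: "?I \<noteq> {}"
  have sub: "k ` ?I \<subseteq> \<gamma> ` {0..1}" using interior_subset by auto
  have "continuous_on (\<gamma> ` {0..1}) (the_inv_into {0..1} \<gamma>)"
    using continuous_on_inv_into[OF \<gamma>(1) compact_Icc \<gamma>(2)] .
  then have "continuous_on ?I (the_inv_into {0..1} \<gamma> \<circ> k)"
    using k(1) sub by (intro continuous_on_compose) (auto intro: continuous_on_subset)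
  moreover have "inj_on (the_inv_into {0..1} \<gamma> \<circ> k) ?I"
    using inj_on_subset[OF k(2) subset_UNIV] inj_on_subset[OF inj_on_the_inv_into[OF \<gamma>(2)] sub]
    by (rule comp_inj_on)
  ultimately have "DIM(complex) \<le> DIM(real)"
    using invariance_of_dimension[of ?I "the_inv_into {0..1} \<gamma> \<circ> k"] ne by blast
  then show False by simp
qed

lemma interior_UN_closed_empty:
  assumes "finite I" "\<And>i. i \<in> I \<Longrightarrow> closed (A i)" "\<And>i. i \<in> I \<Longrightarrow> interior (A i) = {}"
  shows "interior (\<Union>i\<in>I. A i) = {}"
  using assms
proof (induction I rule: finite_induct)
  case (insert i I)
  then have "interior (A i \<union> (\<Union>i\<in>I. A i)) = interior (A i)"
    by (intro interior_closed_Un_empty_interior) auto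
  then show ?case using insert by simp
qed simp

lemma punctured_sphere_homeomorphism:
  assumes "b \<in> sphere (0 :: real ^ 3) 1"
  obtains j k where "homeomorphism (sphere (0 :: real ^ 3) 1 - {b}) (UNIV :: complex set) j k"
  using homeomorphic_punctured_sphere_affine[of 1 b 0 "UNIV :: complex set"] assms
  by (auto simp: homeomorphic_def)

text \<open>Edges are merely continuous arcs, so it needs an argument that finitely many of them do
  not cover the sphere: in a planar chart each is closed with empty interior.\<close>

lemma drawing_misses_point:
  assumes G: "finite_graph V E" and d: "graph_drawing (top_of_set (sphere (0 :: real ^ 3) 1)) V E f g"
  obtains c where "c \<in> sphere 0 1" "c \<notin> drawn V E f g"
proof -
  \<comment> \<open>An arbitrary point that only serves to define the chart k; the missed point is
    found in its complement.\<close>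
  have "axis 1 1 \<in> sphere (0 :: real ^ 3) 1" by (simp add: norm_axis_1)
  then obtain j and k :: "complex \<Rightarrow> real ^ 3" where jk: "homeomorphism (sphere 0 1 - {axis 1 1}) UNIV j k"
    using punctured_sphere_homeomorphism by blast
  have "\<And>z. j (k z) = z" using jk by (auto simp: homeomorphism_def)
  then have "inj k" by (rule inj_on_inverseI)
  moreover have "continuous_on UNIV k" "range k \<subseteq> sphere 0 1"
    using jk by (auto simp: homeomorphism_def)
  ultimately have k: "continuous_on UNIV k" "inj k" "range k \<subseteq> sphere 0 1" by auto
  have g: "continuous_on {0..1} (g e)" "inj_on (g e) {0..1}" if "e \<in> E" for e
    using d that by (auto simp: graph_drawing_def pathin_canon_iff path_def)
  have "interior (k -` (f ` V) \<union> (\<Union>e\<in>E. k -` (g e ` {0..1}))) = interior (k -` (f ` V))"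
  proof (rule interior_closed_Un_empty_interior)
    have "finite (k -` (f ` V))"
      using k(2) G by (intro finite_vimageI) (auto simp: finite_graph_def)
    then show "closed (k -` (f ` V))" by (rule finite_imp_closed)
    show "interior (\<Union>e\<in>E. k -` (g e ` {0..1})) = {}"
    proof (rule interior_UN_closed_empty[OF finite_graph_finite_edges[OF G]])
      fix e assume e: "e \<in> E"
      have "compact (g e ` {0..1})" using g[OF e] by (intro compact_continuous_image) auto
      then show "closed (k -` (g e ` {0..1}))"
        using k(1) by (intro closed_vimage compact_imp_closed)
      show "interior (k -` (g e ` {0..1})) = {}"
        using interior_vimage_arc_empty[OF k(1,2) g[OF e]] .
    qed
  qed
  also have "\<dots> = {}"
    using k(2) G by (intro empty_interior_finite finite_vimageI) (auto simp: finite_graph_def)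
  finally have "k -` (f ` V) \<union> (\<Union>e\<in>E. k -` (g e ` {0..1})) \<noteq> UNIV" by auto
  then obtain z where "z \<notin> k -` (f ` V) \<union> (\<Union>e\<in>E. k -` (g e ` {0..1}))" by blast
  then have "k z \<notin> drawn V E f g" by (auto simp: drawn_def)
  then show thesis using that k(3) by blast
qed

theorem sphere_girth_6_bound:
  assumes G: "finite_graph V E" and d: "graph_drawing (top_of_set (sphere (0 :: real ^ 3) 1)) V E f g"
    and "4 \<le> card V" "\<And>c. graph_cycle E c \<Longrightarrow> 6 \<le> length c"
  shows "2 * card E + 6 \<le> 3 * card V"
proof -
  obtain c where c: "c \<in> sphere 0 1" "c \<notin> drawn V E f g" using drawing_misses_point[OF G d] .
  obtain j k where jk: "homeomorphism (sphere (0 :: real ^ 3) 1 - {c}) (UNIV :: complex set) j k"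
    using punctured_sphere_homeomorphism[OF c(1)] .
  have "graph_drawing (top_of_set (sphere 0 1 - {c})) V E f g"
  proof -
    have "g e ` {0..1} \<subseteq> sphere 0 1 - {c}" if "e \<in> E" for e
      using graph_drawing_in_topspace[OF d that] c(2) that by (auto simp: drawn_def)
    moreover have "f ` V \<subseteq> sphere 0 1 - {c}" using d c(2) by (auto simp: graph_drawing_def drawn_def)
    ultimately show ?thesis
      using d unfolding graph_drawing_def pathin_canon_iff by (auto simp: image_subset_iff)
  qed
  moreover have "continuous_map (top_of_set (sphere 0 1 - {c})) euclidean j"
    using jk by (simp add: homeomorphism_def)
  moreover have "inj_on j (topspace (top_of_set (sphere 0 1 - {c})))"
    using jk by (auto simp: homeomorphism_def intro: inj_on_inverseI[where g=k])
  ultimately have "graph_drawing euclidean V E (j \<circ> f) (\<lambda>e. j \<circ> g e)"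
    by (rule graph_drawing_compose)
  then show ?thesis
    using planar_girth_6_bound[of V E "j \<circ> f" "\<lambda>e. j \<circ> g e"] assms by (simp add: plane_drawing_def)
qed

lemma planar_imp_plane_drawing:
  assumes "finite_graph V E" "planar V E"
  obtains f g where "plane_drawing V E f g"
proof -
  obtain f and g :: "'a set \<Rightarrow> real \<Rightarrow> real ^ 2" where d: "graph_drawing euclidean V E f g"
    using assms(2) by (auto simp: planar_def embeddable_in_def)
  let ?h = "\<lambda>v :: real ^ 2. complex_of_real (v $ 1) + \<i> * complex_of_real (v $ 2)"
  have "continuous_map euclidean euclidean ?h"
    by (simp, intro continuous_intros)
  moreover have "inj_on ?h (topspace euclidean)"
    by (auto simp: inj_on_def complex_eq_iff vec_eq_iff forall_2)
  ultimately have "graph_drawing euclidean V E (?h \<circ> f) (\<lambda>e. ?h \<circ> g e)"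
    by (rule graph_drawing_compose[OF d])
  then show thesis using that assms(1) by (auto simp: plane_drawing_def)
qed


section \<open>Drawings in the projective plane\<close>

text \<open>The Veronese map, sending x to the matrix x x^T. It identifies exactly antipodal points
  and so realises the projective plane inside a Euclidean space, as a set to which
  \<open>covering_space\<close> applies.\<close>

definition outer :: "real ^ 'n \<Rightarrow> real ^ 'n ^ 'n" where
  "outer x = (\<chi> i j. x $ i * x $ j)"

lemma outer_nth: "outer x $ i = x $ i *\<^sub>R x"
  by (simp add: outer_def vec_eq_iff)

lemma outer_uminus [simp]: "outer (- x) = outer x"
  by (simp add: outer_def)

lemma outer_eq_imp:
  assumes "outer x = outer y"
  shows "y = x \<or> y = - x"
proof (cases "x = 0")
  case True
  then have "y $ i * y $ i = 0" for i using assms by (auto simp: outer_def vec_eq_iff)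
  then show ?thesis using True by (simp add: vec_eq_iff)
next
  case False
  then obtain i where i: "x $ i \<noteq> 0" by (auto simp: vec_eq_iff)
  have eq: "x $ i * x $ j = y $ i * y $ j" for j using assms by (simp add: outer_def vec_eq_iff)
  have "y $ i = x $ i \<or> y $ i = - x $ i"
    using eq[of i] by (metis square_eq_iff)
  then show ?thesis
  proof
    assume "y $ i = x $ i"
    then have "x $ i * y $ j = x $ i * x $ j" for j using eq[of j] by metis
    then have "y $ j = x $ j" for j using i mult_left_cancel by blast
    then show ?thesis by (simp add: vec_eq_iff)
  next
    assume "y $ i = - x $ i"
    then have "x $ i * y $ j = x $ i * - (x $ j)" for j
      using eq[of j] by (metis minus_mult_minus mult_minus_left mult_minus_right)
    then have "y $ j = - x $ j" for j using i mult_left_cancel by blast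
    then show ?thesis by (simp add: vec_eq_iff)
  qed
qed

lemma continuous_on_outer: "continuous_on S outer"
  unfolding outer_def by (intro continuous_on_vec_lambda continuous_intros)

text \<open>Where the i-th diagonal entry is positive, the two sheets are the parts of the sphere
  with positive and with negative i-th coordinate.\<close>

lemma covering_space_outer:
  "covering_space (sphere (0 :: real ^ 'n) 1) outer (outer ` sphere 0 1)"
  unfolding covering_space_def
proof (intro conjI ballI continuous_on_outer refl)
  let ?S = "sphere (0 :: real ^ 'n) 1"
  fix m assume "m \<in> outer ` ?S"
  then obtain w where w: "w \<in> ?S" "m = outer w" by blast
  then obtain i where i: "w $ i \<noteq> 0" by (metis norm_zero mem_sphere_0 vec_eq_iff zero_index zero_neq_one)
  define T where "T = {m \<in> outer ` ?S. 0 < m $ i $ i}"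
  define U where "U s = {x \<in> ?S. 0 < s * x $ i}" for s :: real
  \<comment> \<open>Row i of \<open>outer x\<close> is x scaled by its i-th coordinate, whose
    absolute value is the root of the diagonal entry. So q s recovers the preimage whose i-th
    coordinate has the sign s.\<close>
  define q where "q s m = (s / sqrt (m $ i $ i)) *\<^sub>R (m $ i)" for s :: real and m :: "real ^ 'n ^ 'n"
  have outerT: "outer x \<in> T \<longleftrightarrow> x $ i \<noteq> 0" if "x \<in> ?S" for x
    using that by (auto simp: T_def outer_nth zero_less_mult_iff)
  have homeo: "homeomorphism (U s) T outer (q s)" if s: "s = 1 \<or> s = -1" for s
  proof (rule homeomorphismI)
    show "continuous_on (U s) outer" by (rule continuous_on_outer)
    show "continuous_on T (q s)"
      unfolding q_def by (intro continuous_intros) (auto simp: T_def)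
    have Uq: "q s (outer x) = x" if "x \<in> U s" for x
    proof -
      have "sqrt (x $ i * x $ i) = s * x $ i"
        using that s by (auto simp: U_def real_sqrt_mult_self)
      moreover have "s * x $ i \<noteq> 0" using that by (auto simp: U_def)
      ultimately show ?thesis using s by (auto simp: q_def outer_nth)
    qed
    then show "\<And>x. x \<in> U s \<Longrightarrow> q s (outer x) = x" .
    show UT: "outer ` U s \<subseteq> T" using outerT by (auto simp: U_def)
    have TU: "\<exists>x \<in> U s. m = outer x" if "m \<in> T" for m
    proof -
      obtain x where x: "x \<in> ?S" "m = outer x" "x $ i \<noteq> 0" using \<open>m \<in> T\<close> outerT by (auto simp: T_def)
      then have "x \<in> U s \<or> - x \<in> U s" using s by (auto simp: U_def)
      then show ?thesis using x(2) outer_uminus by metis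
    qed
    show "q s ` T \<subseteq> U s" using TU Uq by force
    show "\<And>m. m \<in> T \<Longrightarrow> outer (q s m) = m" using TU Uq by force
  qed
  show "\<exists>T. m \<in> T \<and> openin (top_of_set (outer ` ?S)) T \<and>
      (\<exists>v. \<Union> v = ?S \<inter> outer -` T \<and> (\<forall>u\<in>v. openin (top_of_set ?S) u) \<and>
        pairwise disjnt v \<and> (\<forall>u\<in>v. \<exists>q. homeomorphism u T outer q))"
  proof (intro exI conjI)
    show "m \<in> T" using w i outerT by simp
    have "T = outer ` ?S \<inter> {m. 0 < m $ i $ i}" by (auto simp: T_def)
    moreover have "open {m :: real ^ 'n ^ 'n. 0 < m $ i $ i}"
      by (intro open_Collect_less continuous_intros)
    ultimately show "openin (top_of_set (outer ` ?S)) T" by auto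
    show "\<Union> {U 1, U (-1)} = ?S \<inter> outer -` T"
      using outerT by (auto simp: U_def)
    have "openin (top_of_set ?S) (U s)" for s
    proof -
      have "U s = ?S \<inter> {x. 0 < s * x $ i}" by (auto simp: U_def)
      moreover have "open {x :: real ^ 'n. 0 < s * x $ i}"
        by (intro open_Collect_less continuous_intros)
      ultimately show ?thesis by auto
    qed
    then show "\<forall>u\<in>{U 1, U (-1)}. openin (top_of_set ?S) u" by blast
    show "pairwise disjnt {U 1, U (-1)}"
      by (auto simp: pairwise_def disjnt_def U_def)
    show "\<forall>u\<in>{U 1, U (-1)}. \<exists>q. homeomorphism u T outer q" using homeo by blast
  qed
qed

text \<open>The choice inside h is harmless since \<open>outer\<close> agrees on x and - x;
  continuity follows from the quotient map.\<close>

lemma projective_plane_embedding: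
  obtains h :: "(real ^ 3) set \<Rightarrow> real ^ 3 ^ 3"
  where "continuous_map real_projective_plane (top_of_set (outer ` sphere 0 1)) h"
    and "inj_on h (topspace real_projective_plane)"
proof
  let ?S = "sphere (0 :: real ^ 3) 1"
  define h where "h A = outer (SOME x. x \<in> A)" for A :: "(real ^ 3) set"
  have h: "h {x, - x} = outer x" for x
  proof -
    have "(SOME y. y \<in> {x, - x}) \<in> {x, - x}" by (rule someI[of _ x]) simp
    then show ?thesis by (auto simp: h_def)
  qed
  have top: "topspace real_projective_plane = (\<lambda>x. {x, - x}) ` ?S"
    by (simp add: real_projective_plane_def topspace_quotient_topology)
  have "continuous_map (top_of_set ?S) (top_of_set (outer ` ?S)) (h \<circ> (\<lambda>x. {x, - x}))"
    using continuous_on_outer[of ?S] by (auto simp: o_def h)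
  then show "continuous_map real_projective_plane (top_of_set (outer ` ?S)) h"
    unfolding real_projective_plane_def
    using continuous_compose_quotient_map_eq[OF quotient_map_quotient_topology] by blast
  show "inj_on h (topspace real_projective_plane)"
    unfolding top by (auto simp: inj_on_def h dest!: outer_eq_imp)
qed

text \<open>A shortest segment of the cycle whose two ends have the same projection projects to a cycle.\<close>

lemma graph_cycle_project:
  assumes cov: "\<And>x y. {x, y} \<in> E' \<Longrightarrow> {\<pi> x, \<pi> y} \<in> E \<and> \<pi> x \<noteq> \<pi> y"
    and unique: "\<And>x y z. {x, y} \<in> E' \<Longrightarrow> {x, z} \<in> E' \<Longrightarrow> \<pi> y = \<pi> z \<Longrightarrow> y = z"
    and c: "graph_cycle E' c"
  obtains d where "graph_cycle E d" "length d \<le> length c"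
proof (cases "distinct (map \<pi> c)")
  case True
  have "graph_cycle E (map \<pi> c)"
    unfolding graph_cycle_def
  proof (intro conjI allI impI)
    fix i assume i: "i < length (map \<pi> c)"
    then have "{c ! i, c ! (Suc i mod length c)} \<in> E'" using c by (simp add: graph_cycle_def)
    moreover have "Suc i mod length c < length c" using i by (intro mod_less_divisor) auto
    ultimately show "{map \<pi> c ! i, map \<pi> c ! (Suc i mod length (map \<pi> c))} \<in> E" using cov i by simp
  qed (use True c in \<open>auto simp: graph_cycle_def\<close>)
  then show ?thesis using that by simp
next
  case False
  have n: "3 \<le> length c" and dist: "distinct c"
    and edge: "\<And>i. Suc i < length c \<Longrightarrow> {c ! i, c ! Suc i} \<in> E'"
    using c unfolding graph_cycle_def by (auto, metis Suc_lessD mod_less)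
  define P where "P d \<longleftrightarrow> 0 < d \<and> (\<exists>i. i + d < length c \<and> \<pi> (c ! i) = \<pi> (c ! (i + d)))" for d
  have "\<exists>d. P d"
  proof -
    obtain i j where ij: "i < j" "j < length c" "\<pi> (c ! i) = \<pi> (c ! j)"
      using False by (auto simp: distinct_conv_nth) (metis nat_neq_iff)
    then have "P (j - i)" unfolding P_def by (intro conjI exI[of _ i]) auto
    then show ?thesis ..
  qed
  then obtain d where d: "P d" "\<And>d'. P d' \<Longrightarrow> d \<le> d'"
    using exists_least_iff[of P] not_le by metis
  then obtain i where i: "0 < d" "i + d < length c" "\<pi> (c ! i) = \<pi> (c ! (i + d))"
    by (auto simp: P_def)
  \<comment> \<open>The ends of an edge have different projections, and by \<open>unique\<close> two
    successive edges with equal projected ends would return to their start. So the projected segment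
    has at least three edges.\<close>
  have "d \<noteq> 1"
    using cov[OF edge[of i]] i by auto
  moreover have "d \<noteq> 2"
  proof
    assume d2: "d = 2"
    have "{c ! Suc i, c ! i} \<in> E'" "{c ! Suc i, c ! (i + 2)} \<in> E'"
      using edge[of i] edge[of "Suc i"] i(2) d2 by (simp_all add: insert_commute)
    then have "c ! i = c ! (i + 2)" using unique i(3) d2 by blast
    then show False using dist i(2) d2 by (simp add: nth_eq_iff_index_eq)
  qed
  ultimately have d3: "3 \<le> d" using i(1) by linarith
  let ?w = "map (\<lambda>k. \<pi> (c ! (i + k))) [0..<d]"
  have "graph_cycle E ?w"
    unfolding graph_cycle_def
  proof (intro conjI allI impI)
    show "3 \<le> length ?w" using d3 by simp
    have "k = l" if "k < d" "l < d" "\<pi> (c ! (i + k)) = \<pi> (c ! (i + l))" for k l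
    proof (rule ccontr)
      assume "k \<noteq> l"
      then have "P (max k l - min k l)"
        unfolding P_def using that i(2)
        by (intro conjI exI[of _ "i + min k l"]) (auto simp: max_def min_def split: if_splits)
      then have "d \<le> max k l - min k l" by (rule d(2))
      then show False using that by (auto simp: max_def min_def split: if_splits)
    qed
    then show "distinct ?w" by (auto simp: distinct_map inj_on_def)
  next
    fix k assume k: "k < length ?w"
    then have "{\<pi> (c ! (i + k)), \<pi> (c ! Suc (i + k))} \<in> E"
      using cov[OF edge[of "i + k"]] i(2) by simp
    moreover have "?w ! (Suc k mod length ?w) = \<pi> (c ! Suc (i + k))"
    proof (cases "Suc k = d")
      case True
      then have "\<pi> (c ! Suc (i + k)) = \<pi> (c ! (i + d))" by (metis add_Suc_right)
      then show ?thesis using True i(1,3) by simp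
    next
      case False
      then show ?thesis using k by simp
    qed
    ultimately show "{?w ! k, ?w ! (Suc k mod length ?w)} \<in> E" using k by simp
  qed
  then show ?thesis using that[of ?w] i(2) by simp
qed

text \<open>The lifted graph has points of the sphere as vertices, so it is drawn with
  \<open>id\<close>. Two vertices below give the four that the sphere bound requires.\<close>

theorem projective_girth_6_bound:
  assumes G: "finite_graph V E" and proj: "projective_planar V E" and "2 \<le> card V"
    and girth: "\<And>c. graph_cycle E c \<Longrightarrow> 6 \<le> length c"
  shows "2 * card E + 3 \<le> 3 * card V"
proof -
  let ?S = "sphere (0 :: real ^ 3) 1"
  obtain f0 g0 where d0: "graph_drawing real_projective_plane V E f0 g0"
    using proj by (auto simp: projective_planar_def embeddable_in_def)
  obtain h where h: "continuous_map real_projective_plane (top_of_set (outer ` ?S)) h"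
    "inj_on h (topspace real_projective_plane)"
    using projective_plane_embedding by blast
  define f g where "f = h \<circ> f0" and "g = (\<lambda>e. h \<circ> g0 e)"
  have d: "graph_drawing (top_of_set (outer ` ?S)) V E f g"
    using graph_drawing_compose[OF d0 h] by (simp add: f_def g_def)
  have f: "inj_on f V" "f ` V \<subseteq> outer ` ?S" using d by (auto simp: graph_drawing_def)
  have g: "path (g e)" "path_image (g e) \<subseteq> outer ` ?S" "inj_on (g e) {0..1}"
    "{g e 0, g e 1} = f ` e" "g e ` {0<..<1} \<inter> f ` V = {}" if "e \<in> E" for e
    using d that unfolding graph_drawing_def pathin_canon_iff path_image_def by blast+
  have edge: "e \<subseteq> V" "card e = 2" if "e \<in> E" for e using G that by (auto simp: finite_graph_def)
  have finV: "finite V" and finE: "finite E" using G finite_graph_finite_edges by (auto simp: finite_graph_def)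
  have "\<forall>e\<in>E. \<exists>k. path k \<and> path_image k \<subseteq> ?S \<and> (\<forall>t\<in>{0..1}. outer (k t) = g e t)"
    using covering_space_lift_path[OF covering_space_outer g(1,2)] by metis
  then obtain k where k: "\<And>e. e \<in> E \<Longrightarrow> path (k e) \<and> path_image (k e) \<subseteq> ?S \<and> (\<forall>t\<in>{0..1}. outer (k e t) = g e t)"
    by metis
  have kS: "k e t \<in> ?S" if "e \<in> E" "t \<in> {0..1}" for e t
  proof -
    have "k e t \<in> path_image (k e)" using that(2) by (simp add: path_image_def)
    then show ?thesis using k[OF that(1)] by blast
  qed
  \<comment> \<open>The lifts of \<open>g e\<close> are \<open>k e\<close> and its antipode, so a
    lifted edge is indexed by an edge and a sign.\<close>
  define Sg where "Sg = {1, - 1 :: real}"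
  define I where "I = E \<times> Sg"
  define lift where "lift i t = snd i *\<^sub>R k (fst i) t" for i and t :: real
  define ends where "ends i = {lift i 0, lift i 1}" for i
  define E2 where "E2 = ends ` I"
  define V2 where "V2 = {x \<in> ?S. outer x \<in> f ` V}"
  have I: "fst i \<in> E" "snd i = 1 \<or> snd i = -1" if "i \<in> I" for i using that by (auto simp: I_def Sg_def)
  have lift: "lift i t \<in> ?S" "outer (lift i t) = g (fst i) t" if "i \<in> I" "t \<in> {0..1}" for i t
  proof -
    have "k (fst i) t \<in> ?S" "outer (k (fst i) t) = g (fst i) t"
      using k[OF I(1)[OF that(1)]] kS[OF I(1)[OF that(1)] that(2)] that(2) by auto
    then show "lift i t \<in> ?S" "outer (lift i t) = g (fst i) t"
      using I(2)[OF that(1)] by (auto simp: lift_def)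
  qed
  have lift_inj: "i = j \<and> s = t"
    if "i \<in> I" "j \<in> I" "s \<in> {0..1}" "t \<in> {0..1}" "fst i = fst j" "lift i s = lift j t" for i j s t
  proof -
    have "g (fst i) s = g (fst i) t" using lift(2)[OF that(1,3)] lift(2)[OF that(2,4)] that(5,6) by simp
    then have st: "s = t" using g(3)[OF I(1)[OF that(1)]] that by (auto dest: inj_onD)
    have "k (fst i) s \<noteq> 0" using kS[OF I(1)[OF that(1)] that(3)] by auto
    then have "snd i = snd j" using that(5,6) st by (simp add: lift_def)
    then show ?thesis using st that(5) by (simp add: prod_eq_iff)
  qed
  have ends_outer: "outer ` ends i = f ` fst i" if "i \<in> I" for i
    using lift(2)[OF that] g(4)[OF I(1)[OF that]] by (simp add: ends_def)
  have fst_eq: "fst i = fst j" if "i \<in> I" "j \<in> I" "outer ` ends i = outer ` ends j" for i j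
    using that f(1) edge(1)[OF I(1)] ends_outer by (metis inj_on_image_eq_iff)
  \<comment> \<open>Edges are sets of endpoints, so \<open>card E2 = 2 * card E\<close> requires
    that distinct lifts have distinct ends.\<close>
  have ends_inj: "i = j" if ij: "i \<in> I" "j \<in> I" "ends i = ends j" for i j
  proof -
    have "fst i = fst j" using fst_eq[OF ij(1,2)] ij(3) by simp
    moreover have "lift i 0 = lift j 0 \<or> lift i 0 = lift j 1" using ij(3) by (auto simp: ends_def)
    ultimately show ?thesis using lift_inj[of i j 0 0] lift_inj[of i j 0 1] ij by auto
  qed
  then have inj: "inj_on ends I" by (rule inj_onI)
  have ends_card: "card (ends i) = 2" if "i \<in> I" for i
  proof -
    have "lift i 0 \<noteq> lift i 1" using lift_inj[of i i 0 1] that by auto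
    then show ?thesis by (simp add: ends_def)
  qed
  have ends_V2: "ends i \<subseteq> V2" if "i \<in> I" for i
  proof -
    have "outer ` ends i \<subseteq> f ` V" using ends_outer[OF that] edge(1)[OF I(1)[OF that]] by blast
    then show ?thesis using lift(1)[OF that] by (auto simp: V2_def ends_def)
  qed
  have card_Sg: "card Sg = 2" by (simp add: Sg_def)
  have V2: "finite V2 \<and> card V2 = 2 * card V"
  proof -
    have "\<forall>v\<in>V. \<exists>x\<in>?S. outer x = f v" using f(2) by (metis image_iff image_subset_iff)
    then obtain \<xi> where \<xi>: "\<And>v. v \<in> V \<Longrightarrow> \<xi> v \<in> ?S \<and> outer (\<xi> v) = f v" by metis
    let ?q = "\<lambda>(v, s). s *\<^sub>R \<xi> v"
    have q: "?q (v, s) \<in> ?S \<and> outer (?q (v, s)) = f v" if "v \<in> V" "s \<in> Sg" for v s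
      using \<xi>[OF that(1)] that(2) by (auto simp: Sg_def)
    have "V2 = ?q ` (V \<times> Sg)"
    proof (intro equalityI subsetI)
      fix x assume "x \<in> V2"
      then obtain v where v: "v \<in> V" "outer (\<xi> v) = outer x" using \<xi> by (auto simp: V2_def)
      then have "x = ?q (v, 1) \<or> x = ?q (v, -1)" using outer_eq_imp[OF v(2)] by simp
      then show "x \<in> ?q ` (V \<times> Sg)" using v(1) unfolding Sg_def by blast
    next
      fix x assume "x \<in> ?q ` (V \<times> Sg)"
      then show "x \<in> V2" using q by (auto simp: V2_def)
    qed
    moreover have "inj_on ?q (V \<times> Sg)"
    proof (rule inj_onI)
      fix a b assume ab: "a \<in> V \<times> Sg" "b \<in> V \<times> Sg" "?q a = ?q b"
      then have "f (fst a) = f (fst b)" using q[of "fst a" "snd a"] q[of "fst b" "snd b"] by auto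
      then have "fst a = fst b" using f(1) ab by (auto dest: inj_onD)
      moreover have "\<xi> (fst a) \<noteq> 0" using \<xi>[of "fst a"] ab(1) by auto
      ultimately show "a = b" using ab(3) by (auto simp: case_prod_beta prod_eq_iff)
    qed
    moreover have "finite Sg" by (simp add: Sg_def)
    ultimately show ?thesis using finV card_Sg by (simp add: card_image card_cartesian_product)
  qed
  have card_E2: "card E2 = 2 * card E"
    unfolding E2_def using card_image[OF inj] card_Sg by (simp add: I_def card_cartesian_product)
  have G2: "finite_graph V2 E2"
    using V2 ends_V2 ends_card by (auto simp: finite_graph_def E2_def)
  define g2 where "g2 e = lift (the_inv_into I ends e)" for e
  have g2: "g2 (ends i) = lift i" if "i \<in> I" for i
    using the_inv_into_f_f[OF inj that] by (simp add: g2_def)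
  have "graph_drawing (top_of_set ?S) V2 E2 id g2"
    unfolding graph_drawing_def
  proof (intro conjI ballI impI)
    show "inj_on id V2" "id ` V2 \<subseteq> topspace (top_of_set ?S)" by (auto simp: V2_def)
  next
    fix e assume "e \<in> E2"
    then obtain i where i: "i \<in> I" "e = ends i" by (auto simp: E2_def)
    have "path (lift i)"
      using k[OF I(1)[OF i(1)]] unfolding lift_def path_def by (intro continuous_intros) auto
    then show "pathin (top_of_set ?S) (g2 e)"
      using lift(1)[OF i(1)] unfolding i(2) g2[OF i(1)] pathin_canon_iff by auto
    show "inj_on (g2 e) {0..1}"
      unfolding i(2) g2[OF i(1)] using lift_inj[OF i(1) i(1)] by (intro inj_onI) blast
    show "{g2 e 0, g2 e 1} = id ` e" unfolding i(2) g2[OF i(1)] by (simp add: ends_def)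
    have "lift i t \<notin> V2" if "t \<in> {0<..<1}" for t
    proof -
      have "g (fst i) t \<notin> f ` V" using g(5)[OF I(1)[OF i(1)]] that by blast
      then show ?thesis using lift(2)[OF i(1), of t] that by (simp add: V2_def)
    qed
    then show "g2 e ` {0<..<1} \<inter> id ` V2 = {}"
      unfolding i(2) g2[OF i(1)] by auto
  next
    fix e e' assume "e \<in> E2" "e' \<in> E2" "e \<noteq> e'"
    then obtain i j where ij: "i \<in> I" "e = ends i" "j \<in> I" "e' = ends j" "i \<noteq> j"
      by (auto simp: E2_def)
    have "lift i s \<noteq> lift j t" if "s \<in> {0<..<1}" "t \<in> {0<..<1}" for s t
    proof
      assume eq: "lift i s = lift j t"
      then have "g (fst i) s = g (fst j) t"
        using lift(2)[OF ij(1), of s] lift(2)[OF ij(3), of t] that by simp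
      moreover have "g (fst i) ` {0<..<1} \<inter> g (fst j) ` {0<..<1} = {}" if "fst i \<noteq> fst j"
        using d I(1)[OF ij(1)] I(1)[OF ij(3)] that by (simp add: graph_drawing_def)
      ultimately have "fst i = fst j" using that by blast
      then show False using lift_inj[of i j s t] ij that eq by auto
    qed
    then show "g2 e ` {0<..<1} \<inter> g2 e' ` {0<..<1} = {}"
      unfolding ij(2,4) g2[OF ij(1)] g2[OF ij(3)] by blast
  qed
  moreover have "6 \<le> length c" if c: "graph_cycle E2 c" for c
  proof -
    define \<pi> where "\<pi> x = the_inv_into V f (outer x)" for x
    have \<pi>: "\<pi> x \<in> V" "f (\<pi> x) = outer x" if "outer x \<in> f ` V" for x
      using that f(1) unfolding \<pi>_def
      by (auto simp: f_the_inv_into_f the_inv_into_f_f)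
    have proj_edge: "{\<pi> x, \<pi> y} = fst i \<and> \<pi> x \<noteq> \<pi> y" if "i \<in> I" "{x, y} = ends i" for i x y
    proof -
      have xy: "x \<in> V2" "y \<in> V2" using ends_V2[OF that(1)] that(2) by auto
      then have "f ` {\<pi> x, \<pi> y} = f ` fst i"
        using ends_outer[OF that(1)] \<pi> unfolding that(2)[symmetric] by (auto simp: V2_def)
      then have eq: "{\<pi> x, \<pi> y} = fst i"
        using inj_on_image_eq_iff[OF f(1), of "{\<pi> x, \<pi> y}" "fst i"] \<pi> xy edge(1)[OF I(1)[OF that(1)]]
        by (auto simp: V2_def)
      moreover have "\<pi> x \<noteq> \<pi> y" using edge(2)[OF I(1)[OF that(1)]] unfolding eq[symmetric] by auto
      ultimately show ?thesis ..
    qed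
    \<comment> \<open>Unique lifting: two lifts of one edge that share the end x are the same lift,
      so their other ends agree. Thus a cycle above does not backtrack when projected.\<close>
    have "y = z" if xyz: "{x, y} \<in> E2" "{x, z} \<in> E2" "\<pi> y = \<pi> z" for x y z
    proof -
      obtain i j where ij: "i \<in> I" "{x, y} = ends i" "j \<in> I" "{x, z} = ends j"
        using xyz(1,2) unfolding E2_def by blast
      have "fst i = fst j" using proj_edge[OF ij(1,2)] proj_edge[OF ij(3,4)] xyz(3) by simp
      moreover have "\<exists>s\<in>{0..1}. lift i s = x" "\<exists>t\<in>{0..1}. lift j t = x"
        using ij(2,4) by (auto simp: ends_def doubleton_eq_iff)
      ultimately have "i = j" using lift_inj ij(1,3) by metis
      then have "{x, y} = {x, z}" using ij by simp
      then show ?thesis by (auto simp: doubleton_eq_iff)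
    qed
    moreover have "{\<pi> x, \<pi> y} \<in> E \<and> \<pi> x \<noteq> \<pi> y" if xy: "{x, y} \<in> E2" for x y
    proof -
      obtain i where "i \<in> I" "{x, y} = ends i" using xy unfolding E2_def by blast
      then show ?thesis using proj_edge I(1) by metis
    qed
    ultimately obtain c' where "graph_cycle E c'" "length c' \<le> length c"
      using graph_cycle_project[of E2 \<pi> E c] c by blast
    then show ?thesis using girth by fastforce
  qed
  moreover have "4 \<le> card V2" using V2 assms(3) by linarith
  ultimately have "2 * card E2 + 6 \<le> 3 * card V2"
    by (intro sphere_girth_6_bound[OF G2])
  then show ?thesis using card_E2 V2 by linarith
qed


section \<open>Coloring\<close>

theorem corollary1p3:
  fixes V :: "'a set" and E :: "'a set set"
  assumes "finite_graph V E"
    and "planar V E \<or> projective_planar V E"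
    and "girth E \<ge> 6"
  shows "\<forall>\<sigma> :: 'a set \<Rightarrow> edge_sign. circular_3_colorable V E \<sigma>"
proof
  fix \<sigma> :: "'a set \<Rightarrow> edge_sign"
  have six: "6 \<le> length c" if "graph_cycle E c" for c
  proof -
    have "girth E \<le> enat (length c)" using that unfolding girth_def by (intro INF_lower) simp
    then have "6 \<le> enat (length c)" using assms(3) by (rule order_trans[rotated])
    then show ?thesis by (simp add: numeral_eq_enat)
  qed
  show "circular_3_colorable V E \<sigma>"
  proof (rule sparse_circular_3_colorable[OF assms(1)])
    fix A assume A: "A \<subseteq> V" "A \<noteq> {}"
    let ?E = "{e \<in> E. e \<subseteq> A}"
    have finA: "finite A" using A(1) assms(1) finite_subset by (auto simp: finite_graph_def)
    have G: "finite_graph A ?E" using finA assms(1) by (auto simp: finite_graph_def)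
    have girth: "6 \<le> length c" if "graph_cycle ?E c" for c
      using that by (intro six) (auto simp: graph_cycle_def)
    have embed: "embeddable_in X A ?E" if "embeddable_in X V E" for X :: "'b topology"
      using that A(1) graph_drawing_subset[of X V E _ _ A ?E] unfolding embeddable_in_def by blast
    show "2 * card ?E + 3 \<le> 3 * card A"
    proof (cases "4 \<le> card A")
      case True
      from assms(2) show ?thesis
      proof
        assume "planar V E"
        then have "planar A ?E" using embed unfolding planar_def by blast
        then obtain f g where "plane_drawing A ?E f g" using planar_imp_plane_drawing[OF G] by blast
        then show ?thesis using planar_girth_6_bound[OF _ True girth] by fastforce
      next
        assume "projective_planar V E"
        then have "projective_planar A ?E" using embed unfolding projective_planar_def by blast
        then show ?thesis using projective_girth_6_bound[OF G _ _ girth] True by simp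
      qed
    next
      case False
      \<comment> \<open>Fewer than four vertices have no room for a cycle of length six, and a
        forest satisfies 2 (|A| - 1) + 3 \<le> 3 |A|.\<close>
      have "\<not> graph_cycle ?E c" for c
      proof
        assume c: "graph_cycle ?E c"
        then have "set c \<subseteq> A" by (fastforce simp: graph_cycle_def in_set_conv_nth)
        then have "length c \<le> card A"
          using c card_mono[OF finA, of "set c"] by (simp add: graph_cycle_def distinct_card)
        then show False using girth[OF c] False by linarith
      qed
      then have "card ?E + 1 \<le> card A" using card_acyclic[OF G _ A(2)] by blast
      then show ?thesis by linarith
    qed
  qed
qed

end
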